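(* Let $\Omega\subset\mathbb R^N$ be a bounded domain which, for every $i=1,\dots,N$, is convex in the $x_i$ direction and symmetric with respect to the hyperplane $\{x_i=0\}$. Let $f\in C^1(\mathbb R)$ and let $u\in C^2(\Omega)\cap C(\overline\Omega)$ satisfy $$-\Delta u=f(u)\ \text{in }\Omega,\qquad u>0\ \text{in }\Omega,\qquad u=0\ \text{on }\partial\Omega.$$ Then the Hessian matrix of $u$ at the origin is diagonal and negative definite. *)

theory Defs
  imports "HOL-Analysis.Analysis"
begin

definition reflect_coord :: "'n \<Rightarrow> real ^ 'n \<Rightarrow> real ^ 'n" where
  "reflect_coord i x = (\<chi> j. if j = i then - (x $ j) else x $ j)"

definition symmetric_in_direction :: "'n \<Rightarrow> (real ^ 'n) set \<Rightarrow> bool" where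
  "symmetric_in_direction i S \<longleftrightarrow> (\<forall>x\<in>S. reflect_coord i x \<in> S)"

definition convex_in_direction :: "'n \<Rightarrow> (real ^ 'n) set \<Rightarrow> bool" where
  "convex_in_direction i S \<longleftrightarrow>
     (\<forall>x\<in>S. \<forall>y\<in>S. (\<forall>j. j \<noteq> i \<longrightarrow> x $ j = y $ j) \<longrightarrow> closed_segment x y \<subseteq> S)"

definition diagonal_matrix :: "real ^ 'n ^ 'n \<Rightarrow> bool" where
  "diagonal_matrix A \<longleftrightarrow> (\<forall>i j. i \<noteq> j \<longrightarrow> A $ i $ j = 0)"

definition negative_definite :: "real ^ 'n ^ 'n \<Rightarrow> bool" where
  "negative_definite A \<longleftrightarrow> (\<forall>v. v \<noteq> 0 \<longrightarrow> v \<bullet> (A *v v) < 0)"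

end

(* Moving planes, with elementary barriers in place of integral estimates and regularity theory.

   Convexity and symmetry in every coordinate direction make the domain a union of origin-centred
   boxes, so near each boundary point there is a ball of comparable size outside the domain.
   Comparison with exp (- a |x - y|^2) - exp (- a R^2), y the centre of such a ball, yields a maximum
   principle for thin neighbourhoods of the boundary, which lets the plane move; the same barrier
   gives the strong maximum principle. Hence u is even and decreasing in each coordinate, and the
   mixed derivatives vanish at 0.

   For the strict sign of the pure second derivatives one would apply Hopf's lemma to the derivative
   of u, which need not be twice differentiable. Instead the barrier is compared with the difference
   u (x - s e) - u (x + s e), divided by 2 s, as s tends to 0. *)
theory Submission
  imports Defs
begin

section \<open>Second derivatives and Laplacians at a single point\<close>

text \<open>A relation that sees \<open>g\<close> only near 0. Taken along coordinate lines, it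
  treats solutions, reflected solutions and barriers alike, without total derivatives.\<close>

definition has_second_deriv :: "(real \<Rightarrow> real) \<Rightarrow> real \<Rightarrow> bool" where
  "has_second_deriv g c \<longleftrightarrow>
     (\<exists>d. (\<forall>\<^sub>F t in nhds 0. (g has_real_derivative d t) (at t)) \<and> (d has_real_derivative c) (at 0))"

definition has_laplacian :: "(real ^ 'n \<Rightarrow> real) \<Rightarrow> real \<Rightarrow> real ^ 'n \<Rightarrow> bool" where
  "has_laplacian g l p \<longleftrightarrow>
     (\<exists>c. (\<forall>j. has_second_deriv (\<lambda>t. g (p + t *\<^sub>R axis j 1)) (c j)) \<and> l = (\<Sum>j\<in>UNIV. c j))"

lemma has_real_derivative_transfer:
  assumes "\<forall>\<^sub>F t in nhds x. f t = g t" "(f has_real_derivative D) (at x)"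
  shows "(g has_real_derivative D) (at x)"
  using DERIV_cong_ev[OF refl assms(1) refl] assms(2) by simp

lemma has_second_derivI:
  assumes "\<forall>\<^sub>F t in nhds 0. (g has_real_derivative d t) (at t)" "(d has_real_derivative c) (at 0)"
  shows "has_second_deriv g c"
  unfolding has_second_deriv_def using assms by blast

lemma has_second_deriv_diff:
  assumes "has_second_deriv g c" "has_second_deriv h e"
  shows "has_second_deriv (\<lambda>t. g t - h t) (c - e)"
proof -
  obtain d d' where
    d: "\<forall>\<^sub>F t in nhds 0. (g has_real_derivative d t) (at t)" "(d has_real_derivative c) (at 0)"
    and d': "\<forall>\<^sub>F t in nhds 0. (h has_real_derivative d' t) (at t)" "(d' has_real_derivative e) (at 0)"
    using assms unfolding has_second_deriv_def by blast
  have "\<forall>\<^sub>F t in nhds 0. ((\<lambda>t. g t - h t) has_real_derivative d t - d' t) (at t)"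
    using d(1) d'(1) by eventually_elim (rule DERIV_diff)
  then show ?thesis by (rule has_second_derivI[OF _ DERIV_diff[OF d(2) d'(2)]])
qed

lemma has_second_deriv_cmult:
  assumes "has_second_deriv g c"
  shows "has_second_deriv (\<lambda>t. k * g t) (k * c)"
proof -
  obtain d where
    d: "\<forall>\<^sub>F t in nhds 0. (g has_real_derivative d t) (at t)" "(d has_real_derivative c) (at 0)"
    using assms unfolding has_second_deriv_def by blast
  have "\<forall>\<^sub>F t in nhds 0. ((\<lambda>t. k * g t) has_real_derivative k * d t) (at t)"
    using d(1) by eventually_elim (rule DERIV_cmult)
  then show ?thesis by (rule has_second_derivI[OF _ DERIV_cmult[OF d(2)]])
qed

lemma has_second_deriv_minus:
  assumes "has_second_deriv g c"
  shows "has_second_deriv (\<lambda>t. g (- t)) c"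
proof -
  obtain d where
    d: "\<forall>\<^sub>F t in nhds 0. (g has_real_derivative d t) (at t)" "(d has_real_derivative c) (at 0)"
    using assms unfolding has_second_deriv_def by blast
  have "filterlim (uminus :: real \<Rightarrow> real) (nhds 0) (nhds 0)"
    using tendsto_minus[OF filterlim_ident, of "0::real"] by simp
  then have "\<forall>\<^sub>F t in nhds 0. (g has_real_derivative d (- t)) (at (- t))"
    using d(1) by (auto simp: filterlim_iff)
  then have "\<forall>\<^sub>F t in nhds 0. ((\<lambda>t. g (- t)) has_real_derivative - d (- t)) (at t)"
  proof eventually_elim
    case (elim t)
    show ?case using DERIV_mirror[of g "d (- t)" t] elim by simp
  qed
  moreover have "((\<lambda>t. - d (- t)) has_real_derivative c) (at 0)"
    using DERIV_minus[OF DERIV_mirror[THEN iffD1, of d c 0]] d(2) by simp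
  ultimately show ?thesis by (rule has_second_derivI)
qed

lemma has_second_deriv_const: "has_second_deriv (\<lambda>t. k) 0"
  unfolding has_second_deriv_def by (intro exI[of _ "\<lambda>_. 0"]) auto

text \<open>If \<open>c < 0\<close>, the first derivative, which vanishes at the minimum, is
  negative just to the right of 0, so \<open>g\<close> drops below \<open>g 0\<close>.\<close>

lemma second_deriv_local_min:
  assumes "has_second_deriv g c" and min: "\<forall>\<^sub>F t in nhds 0. g 0 \<le> g t"
  shows "c \<ge> 0"
proof (rule ccontr)
  assume "\<not> c \<ge> 0"
  then have "c < 0" by simp
  obtain d where
    d: "\<forall>\<^sub>F t in nhds 0. (g has_real_derivative d t) (at t)" "(d has_real_derivative c) (at 0)"
    using assms unfolding has_second_deriv_def by blast
  obtain e where e: "e > 0" "\<And>t. \<bar>t\<bar> < e \<Longrightarrow> (g has_real_derivative d t) (at t) \<and> g 0 \<le> g t"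
    using eventually_conj[OF d(1) min] unfolding eventually_nhds_metric by (auto simp: dist_real_def)
  have d0: "d 0 = 0"
    by (rule DERIV_local_min[of g "d 0" 0 e]) (use e in auto)
  obtain e' where e': "e' > 0" "\<And>t. 0 < t \<Longrightarrow> t < e' \<Longrightarrow> d (0 + t) < d 0"
    using DERIV_neg_dec_right[OF d(2) \<open>c < 0\<close>] by blast
  define s where "s = min e e' / 2"
  have s: "0 < s" "s < e" "s < e'" using e(1) e'(1) by (auto simp: s_def)
  have "g s < g 0"
  proof (rule DERIV_neg_imp_decreasing_open[OF s(1)])
    show "\<exists>y. (g has_real_derivative y) (at x) \<and> y < 0" if "0 < x" "x < s" for x
      using that e(2)[of x] e'(2)[of x] s d0 by auto
    show "continuous_on {0..s} g"
      by (rule DERIV_continuous_on[where D = d], rule has_field_derivative_at_within)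
         (use e(2) s in auto)
  qed
  with e(2)[of s] s show False by auto
qed

lemma has_laplacian_diff:
  "has_laplacian g l p \<Longrightarrow> has_laplacian h m p \<Longrightarrow> has_laplacian (\<lambda>x. g x - h x) (l - m) p"
  unfolding has_laplacian_def
  by (elim exE conjE, rule_tac x="\<lambda>j. c j - ca j" in exI)
     (auto intro: has_second_deriv_diff simp: sum_subtractf)

lemma has_laplacian_cmult:
  "has_laplacian g l p \<Longrightarrow> has_laplacian (\<lambda>x. k * g x) (k * l) p"
  unfolding has_laplacian_def
  by (elim exE conjE, rule_tac x="\<lambda>j. k * c j" in exI)
     (auto intro: has_second_deriv_cmult simp: sum_distrib_left)

lemma has_laplacian_const: "has_laplacian (\<lambda>x. k) 0 p"
  unfolding has_laplacian_def
  by (rule exI[of _ "\<lambda>_. 0"]) (auto intro: has_second_deriv_const)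

lemma has_laplacian_shift:
  "has_laplacian g l (p + a) \<Longrightarrow> has_laplacian (\<lambda>x. g (x + a)) l p"
  unfolding has_laplacian_def by (simp add: add_ac)

section \<open>Reflections in hyperplanes orthogonal to an axis\<close>

definition plane_reflect :: "'n \<Rightarrow> real \<Rightarrow> real ^ 'n \<Rightarrow> real ^ 'n" where
  "plane_reflect i \<mu> x = x + (2 * (\<mu> - x $ i)) *\<^sub>R axis i 1"

lemma plane_reflect_nth:
  "plane_reflect i \<mu> x $ j = (if j = i then 2 * \<mu> - x $ i else x $ j)"
  by (simp add: plane_reflect_def axis_def)

lemma plane_reflect_axis:
  "plane_reflect i \<mu> (p + t *\<^sub>R axis j 1) = plane_reflect i \<mu> p + (if j = i then - t else t) *\<^sub>R axis j 1"
  by (auto simp: vec_eq_iff plane_reflect_nth axis_def)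

lemma plane_reflect_invol [simp]: "plane_reflect i \<mu> (plane_reflect i \<mu> x) = x"
  by (auto simp: vec_eq_iff plane_reflect_nth)

lemma continuous_on_plane_reflect: "continuous_on S (plane_reflect i \<mu>)"
  unfolding plane_reflect_def by (intro continuous_intros)

text \<open>Reflection maps a coordinate line to a coordinate line, reversing it only in direction
  \<open>i\<close>, and second derivatives are insensitive to reversal.\<close>

lemma has_laplacian_plane_reflect:
  assumes "has_laplacian g l (plane_reflect i \<mu> p)"
  shows "has_laplacian (\<lambda>x. g (plane_reflect i \<mu> x)) l p"
proof -
  obtain c where c: "\<And>j. has_second_deriv (\<lambda>t. g (plane_reflect i \<mu> p + t *\<^sub>R axis j 1)) (c j)"
    and l: "l = (\<Sum>j\<in>UNIV. c j)"
    using assms unfolding has_laplacian_def by blast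
  have "has_second_deriv (\<lambda>t. g (plane_reflect i \<mu> (p + t *\<^sub>R axis j 1))) (c j)" for j
    using c[of j] has_second_deriv_minus[OF c[of j]] unfolding plane_reflect_axis
    by (cases "j = i") auto
  then show ?thesis unfolding has_laplacian_def using l by blast
qed

section \<open>Minimum principle\<close>

lemma eventually_axis_line:
  fixes p :: "real ^ 'n"
  assumes "open S" "p \<in> S"
  shows "\<forall>\<^sub>F t in nhds 0. p + t *\<^sub>R axis j 1 \<in> S"
proof -
  have "((\<lambda>t. p + t *\<^sub>R axis j 1) \<longlongrightarrow> p + 0 *\<^sub>R axis j 1) (nhds (0::real))"
    by (intro tendsto_intros filterlim_ident)
  then show ?thesis using topological_tendstoD[of _ p "nhds 0" S] assms by simp
qed

lemma laplacian_local_min: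
  assumes "has_laplacian g l p" "open S" "p \<in> S" "\<And>x. x \<in> S \<Longrightarrow> g p \<le> g x"
  shows "l \<ge> 0"
proof -
  obtain c where c: "\<And>j. has_second_deriv (\<lambda>t. g (p + t *\<^sub>R axis j 1)) (c j)"
    and l: "l = (\<Sum>j\<in>UNIV. c j)"
    using assms(1) unfolding has_laplacian_def by blast
  have "c j \<ge> 0" for j
    by (rule second_deriv_local_min[OF c],
        rule eventually_mono[OF eventually_axis_line[OF assms(2,3)]]) (use assms(4) in auto)
  then show ?thesis using l by (simp add: sum_nonneg)
qed

text \<open>A negative minimum would be an interior point with negative Laplacian, against the
  second derivative test. The last hypothesis speaks only of points where \<open>g\<close> is
  negative, so boundary values and the differential inequality are checked in one go.\<close>

lemma nonneg_by_laplacian: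
  fixes g :: "real ^ 'n \<Rightarrow> real"
  assumes "compact C" "continuous_on C g" "x \<in> C"
    and neg: "\<And>q. q \<in> C \<Longrightarrow> g q < 0 \<Longrightarrow> q \<in> interior C \<and> (\<exists>l<0. has_laplacian g l q)"
  shows "g x \<ge> 0"
proof (rule ccontr)
  assume "\<not> g x \<ge> 0"
  obtain p where p: "p \<in> C" "\<And>q. q \<in> C \<Longrightarrow> g p \<le> g q"
    using continuous_attains_inf[OF assms(1) _ assms(2)] assms(3) by blast
  then have "g p < 0" using p(2)[OF assms(3)] \<open>\<not> g x \<ge> 0\<close> by linarith
  then obtain l where "l < 0" "has_laplacian g l p" "p \<in> interior C"
    using neg p(1) by blast
  moreover have "l \<ge> 0"
    by (rule laplacian_local_min[of g l p "interior C"])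
       (use calculation p(2) interior_subset in auto)
  ultimately show False by simp
qed

section \<open>The exponential barrier\<close>

text \<open>The bracket is the squared distance to a centre along a coordinate line:
  \<open>A\<close> is its value at \<open>t = 0\<close> and \<open>b\<close> the component of the
  base point minus the centre.\<close>

lemma has_second_deriv_gauss:
  "has_second_deriv (\<lambda>t. exp (- \<alpha> * (A + 2 * t * b + t\<^sup>2)))
     (exp (- \<alpha> * A) * (4 * \<alpha>\<^sup>2 * b\<^sup>2 - 2 * \<alpha>))"
  unfolding has_second_deriv_def
  by (rule exI[of _ "\<lambda>t. exp (- \<alpha> * (A + 2 * t * b + t\<^sup>2)) * (- \<alpha> * (2 * b + 2 * t))"], safe)
     (auto intro!: always_eventually derivative_eq_intros simp: algebra_simps power2_eq_square)

lemma has_laplacian_gauss: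
  fixes y p :: "real ^ 'n" and \<alpha> :: real
  shows "has_laplacian (\<lambda>x. exp (- \<alpha> * (dist x y)\<^sup>2))
     (exp (- \<alpha> * (dist p y)\<^sup>2) * (4 * \<alpha>\<^sup>2 * (dist p y)\<^sup>2 - 2 * CARD('n) * \<alpha>)) p"
proof -
  have line: "(dist (p + t *\<^sub>R axis j 1) y)\<^sup>2 = (dist p y)\<^sup>2 + 2 * t * ((p - y) $ j) + t\<^sup>2" for t j
  proof -
    have "p + t *\<^sub>R axis j 1 - y = (p - y) + t *\<^sub>R axis j 1" by simp
    then show ?thesis
      unfolding dist_norm power2_norm_eq_inner
      by (simp only: inner_add_left inner_add_right)
         (simp add: inner_axis inner_axis' power2_eq_square)
  qed
  have norm: "(dist p y)\<^sup>2 = (\<Sum>j\<in>UNIV. ((p - y) $ j)\<^sup>2)"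
    unfolding dist_norm power2_norm_eq_inner by (simp add: inner_vec_def power2_eq_square)
  show ?thesis
    unfolding has_laplacian_def
    apply (intro exI conjI allI)
     apply (subst line, rule has_second_deriv_gauss)
    apply (simp add: norm sum_distrib_left[symmetric] sum_subtractf)
    done
qed

text \<open>The barrier of Hopf's lemma; the subtracted constant makes it vanish on the sphere of
  radius \<open>R\<close> about \<open>y\<close>.\<close>

definition barrier :: "real \<Rightarrow> real \<Rightarrow> 'a::metric_space \<Rightarrow> 'a \<Rightarrow> real" where
  "barrier \<alpha> R y x = exp (- \<alpha> * (dist x y)\<^sup>2) - exp (- \<alpha> * R\<^sup>2)"

lemma continuous_on_barrier: "continuous_on S (barrier \<alpha> R y)"
  unfolding barrier_def by (intro continuous_intros)

lemma barrier_le_1: "\<alpha> \<ge> 0 \<Longrightarrow> barrier \<alpha> R y x \<le> 1"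
  by (simp add: barrier_def) (smt (verit) exp_ge_zero exp_le_one_iff mult_nonneg_nonneg zero_le_power2)

lemma barrier_pos: "\<alpha> > 0 \<Longrightarrow> dist x y < R \<Longrightarrow> barrier \<alpha> R y x > 0"
  by (simp add: barrier_def power_strict_mono)

lemma has_laplacian_barrier:
  fixes y p :: "real ^ 'n" and \<alpha> :: real
  shows "has_laplacian (barrier \<alpha> R y)
     (exp (- \<alpha> * (dist p y)\<^sup>2) * (4 * \<alpha>\<^sup>2 * (dist p y)\<^sup>2 - 2 * CARD('n) * \<alpha>)) p"
  using has_laplacian_diff[OF has_laplacian_gauss has_laplacian_const[of "exp (- \<alpha> * R\<^sup>2)"]]
  unfolding barrier_def by simp

section \<open>Comparison with the barrier\<close>

text \<open>Quantitative form of the strong maximum principle and of Hopf's lemma. Where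
  \<open>w\<close> is below \<open>m\<close> times the barrier, the point lies off the core, and
  there the Laplacian of the multiple exceeds \<open>L * w\<close>, so the difference has negative
  Laplacian.\<close>

lemma growth_lemma:
  fixes w :: "real ^ 'n \<Rightarrow> real" and L \<alpha> :: real
  assumes cont: "continuous_on (cball y R) w"
    and nonneg: "\<And>x. x \<in> cball y R \<Longrightarrow> w x \<ge> 0"
    and core: "\<And>x. x \<in> cball y \<rho> \<Longrightarrow> x \<in> cball y R \<Longrightarrow> w x \<ge> m"
    and lap: "\<And>x. x \<in> ball y R \<Longrightarrow> \<exists>l. has_laplacian w l x \<and> l \<le> L * w x"
    and pars: "0 < \<rho>" "0 < m" "0 \<le> L" "0 < \<alpha>" "4 * \<alpha>\<^sup>2 * \<rho>\<^sup>2 - 2 * CARD('n) * \<alpha> > L"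
    and x: "x \<in> cball y R"
  shows "w x \<ge> m * barrier \<alpha> R y x"
proof -
  let ?h = "barrier \<alpha> R y"
  have "w x - m * ?h x \<ge> 0"
  proof (rule nonneg_by_laplacian[OF compact_cball _ x, of "\<lambda>x. w x - m * ?h x"])
    show "continuous_on (cball y R) (\<lambda>x. w x - m * ?h x)"
      by (intro continuous_intros cont continuous_on_barrier)
    fix q assume q: "q \<in> cball y R" "w q - m * ?h q < 0"
    \<comment> \<open>On the sphere the barrier is 0 while \<open>w\<close> is nonnegative.\<close>
    have "dist q y \<noteq> R"
      using q nonneg[of q] by (auto simp: barrier_def)
    then have qb: "q \<in> ball y R" using q(1) by (simp add: dist_commute)
    have "m * ?h q \<le> m" using barrier_le_1[of \<alpha> R y q] pars by simp
    then have "dist q y > \<rho>" using core[of q] q by (force simp: dist_commute)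
    then have "(dist q y)\<^sup>2 \<ge> \<rho>\<^sup>2" using pars(1) by (simp add: power_mono)
    then have "4 * \<alpha>\<^sup>2 * \<rho>\<^sup>2 \<le> 4 * \<alpha>\<^sup>2 * (dist q y)\<^sup>2" by (simp add: mult_left_mono)
    then have "4 * \<alpha>\<^sup>2 * (dist q y)\<^sup>2 - 2 * CARD('n) * \<alpha> > L" using pars by linarith
    then have "exp (- \<alpha> * (dist q y)\<^sup>2) * (4 * \<alpha>\<^sup>2 * (dist q y)\<^sup>2 - 2 * CARD('n) * \<alpha>)
        > exp (- \<alpha> * (dist q y)\<^sup>2) * L" (is "?lh > _") by simp
    \<comment> \<open>The exponential dominates the barrier, which differs from it by a positive
      constant.\<close>
    moreover have "exp (- \<alpha> * (dist q y)\<^sup>2) * L \<ge> L * ?h q"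
      using pars(3) by (simp add: barrier_def algebra_simps)
    ultimately have "?lh > L * ?h q" by linarith
    then have lh: "m * ?lh > m * (L * ?h q)" using pars(2) by simp
    obtain l where l: "has_laplacian w l q" "l \<le> L * w q" using lap[OF qb] by blast
    have "L * w q \<le> L * (m * ?h q)" using q(2) pars(3) by (intro mult_left_mono) auto
    then have "l - m * ?lh < 0" using lh l(2) by (simp add: algebra_simps)
    have "has_laplacian (\<lambda>x. w x - m * ?h x) (l - m * ?lh) q"
      by (rule has_laplacian_diff[OF l(1) has_laplacian_cmult[OF has_laplacian_barrier]])
    with \<open>l - m * ?lh < 0\<close> qb
    show "q \<in> interior (cball y R) \<and> (\<exists>l<0. has_laplacian (\<lambda>x. w x - m * ?h x) l q)"
      unfolding interior_cball by blast
  qed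
  then show ?thesis by simp
qed

lemma barrier_exponent_exists:
  fixes \<rho> L :: real
  assumes "\<rho> > 0" "L \<ge> 0" "n \<ge> 1"
  shows "\<exists>\<alpha>>0. 4 * \<alpha>\<^sup>2 * \<rho>\<^sup>2 - 2 * real n * \<alpha> > L"
proof -
  \<comment> \<open>The second entry makes \<open>2 * \<alpha> * \<rho>\<^sup>2 - n\<close> at least
    \<open>L + 1\<close>; the entry 1 lets this bound survive multiplication by \<alpha>.\<close>
  define \<alpha> where "\<alpha> = max 1 ((n + L) / \<rho>\<^sup>2)"
  have a: "\<alpha> \<ge> 1" by (simp add: \<alpha>_def)
  have "(n + L) / \<rho>\<^sup>2 \<le> \<alpha>" by (simp add: \<alpha>_def)
  then have "n + L \<le> \<alpha> * \<rho>\<^sup>2" using assms(1) by (simp add: divide_le_eq)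
  then have "2 * (\<alpha> * \<rho>\<^sup>2) - n \<ge> L + 1" using assms by linarith
  then have "\<alpha> * (2 * (\<alpha> * \<rho>\<^sup>2) - n) \<ge> 1 * (L + 1)" using a assms by (intro mult_mono) auto
  then have "4 * \<alpha>\<^sup>2 * \<rho>\<^sup>2 - 2 * real n * \<alpha> > L"
    using assms(2) by (simp add: algebra_simps power2_eq_square)
  then show ?thesis using a by (intro exI[of _ \<alpha>]) auto
qed

text \<open>Replaces the maximum principle in domains of small measure.\<close>
lemma no_negative_min_near_hole:
  fixes w :: "real ^ 'n \<Rightarrow> real" and L :: real
  assumes S: "open S" "bounded S" and cont: "continuous_on (closure S) w"
    and bd: "\<And>x. x \<in> closure S \<Longrightarrow> x \<notin> S \<Longrightarrow> w x \<ge> 0"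
    and lap: "\<And>x. x \<in> S \<Longrightarrow> \<exists>l. has_laplacian w l x \<and> l \<le> L * \<bar>w x\<bar>"
    and x0: "x0 \<in> S" "w x0 < 0" "\<And>x. x \<in> closure S \<Longrightarrow> w x0 \<le> w x"
    and hole: "cball y \<rho> \<inter> S = {}" "dist x0 y < \<kappa> * \<rho>"
    and pars: "\<rho> > 0" "\<kappa> > 0" "L \<ge> 0"
      "L * \<rho>\<^sup>2 < 2 * (real CARD('n))\<^sup>2 * exp (- real CARD('n) * \<kappa>\<^sup>2)"
  shows False
proof -
  define n where "n = real CARD('n)"
  have n: "n > 0" by (simp add: n_def)
  define R where "R = \<kappa> * \<rho>"
  \<comment> \<open>With this exponent, \<open>\<alpha> * R\<^sup>2\<close> does not depend on
    \<rho>, while the factor of the exponential in the Laplacian is at least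
    \<open>2 * n\<^sup>2 / \<rho>\<^sup>2\<close> outside the hole. Hence a small hole radius beats
    \<open>L\<close>.\<close>
  define \<alpha> where "\<alpha> = n / \<rho>\<^sup>2"
  have \<alpha>: "\<alpha> > 0" using n pars by (simp add: \<alpha>_def)
  let ?h = "barrier \<alpha> R y"
  \<comment> \<open>Comparison of \<open>w\<close> with its minimum times one minus the barrier. On
    the sphere minimality gives \<open>?g \<ge> 0\<close>, off \<open>S\<close> the sign of
    \<open>w\<close> does; at \<open>x0\<close> the value is \<open>w x0\<close> times a positive
    number, which is the contradiction.\<close>
  let ?g = "\<lambda>x. w x - (w x0 - w x0 * ?h x)"
  let ?C = "closure S \<inter> cball y R"
  have "?g x0 \<ge> 0"
  proof (rule nonneg_by_laplacian[of ?C ?g x0])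
    show "compact ?C" using S by (intro compact_Int_closed) (auto simp: compact_closure)
    show "continuous_on ?C ?g"
      by (intro continuous_intros continuous_on_barrier continuous_on_subset[OF cont]) auto
    show "x0 \<in> ?C" using x0(1) hole(2) closure_subset[of S] by (auto simp: R_def dist_commute)
    fix q assume q: "q \<in> ?C" "?g q < 0"
    have "dist q y \<noteq> R" using q x0(3)[of q] by (auto simp: barrier_def)
    then have qb: "q \<in> ball y R" using q(1) by (simp add: dist_commute)
    have "(- w x0) * ?h q \<le> (- w x0) * 1"
      using barrier_le_1[of \<alpha> R y q] \<alpha> x0(2) by (intro mult_left_mono) auto
    then have "w q < 0" using q(2) by simp
    then have qS: "q \<in> S" using bd q(1) by force
    then have r: "dist q y > \<rho>" using hole(1) by (force simp: dist_commute)
    have "\<rho>\<^sup>2 \<le> (dist q y)\<^sup>2" using r pars(1) by (simp add: power_mono)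
    then have "4 * \<alpha>\<^sup>2 * \<rho>\<^sup>2 \<le> 4 * \<alpha>\<^sup>2 * (dist q y)\<^sup>2" by (simp add: mult_left_mono)
    moreover have "4 * \<alpha>\<^sup>2 * \<rho>\<^sup>2 - 2 * n * \<alpha> = 2 * n\<^sup>2 / \<rho>\<^sup>2"
      using pars(1) by (simp add: \<alpha>_def field_simps power2_eq_square)
    ultimately have A: "4 * \<alpha>\<^sup>2 * (dist q y)\<^sup>2 - 2 * n * \<alpha> \<ge> 2 * n\<^sup>2 / \<rho>\<^sup>2" by linarith
    have "(dist q y)\<^sup>2 \<le> R\<^sup>2" using qb by (simp add: dist_commute power_mono)
    then have "\<alpha> * (dist q y)\<^sup>2 \<le> \<alpha> * R\<^sup>2" using \<alpha> by simp
    also have "\<dots> = n * \<kappa>\<^sup>2" using pars(1) by (simp add: \<alpha>_def R_def power_mult_distrib)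
    finally have B: "exp (- n * \<kappa>\<^sup>2) \<le> exp (- \<alpha> * (dist q y)\<^sup>2)" by simp
    let ?lh = "exp (- \<alpha> * (dist q y)\<^sup>2) * (4 * \<alpha>\<^sup>2 * (dist q y)\<^sup>2 - 2 * CARD('n) * \<alpha>)"
    have "L < 2 * n\<^sup>2 * exp (- n * \<kappa>\<^sup>2) / \<rho>\<^sup>2"
      using pars(1,4) by (simp add: less_divide_eq n_def)
    also have "\<dots> = exp (- n * \<kappa>\<^sup>2) * (2 * n\<^sup>2 / \<rho>\<^sup>2)" by simp
    also have "\<dots> \<le> ?lh"
      using A B by (intro mult_mono) (auto simp: n_def)
    finally have "L * (- w x0) < ?lh * (- w x0)" using x0(2) by (intro mult_strict_right_mono) auto
    moreover obtain l where l: "has_laplacian w l q" "l \<le> L * \<bar>w q\<bar>" using lap[OF qS] by blast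
    \<comment> \<open>Minimality of \<open>w x0\<close> bounds the size of \<open>w\<close> at every
      point where it is negative.\<close>
    moreover have "L * \<bar>w q\<bar> \<le> L * (- w x0)"
      using \<open>w q < 0\<close> x0(3)[of q] q(1) pars(3) by (intro mult_left_mono) auto
    ultimately have "l - (0 - w x0 * ?lh) < 0" by (simp add: algebra_simps)
    moreover have "has_laplacian ?g (l - (0 - w x0 * ?lh)) q"
      by (intro has_laplacian_diff l has_laplacian_const has_laplacian_cmult has_laplacian_barrier)
    moreover have "q \<in> interior ?C"
      using qS qb S(1) interior_maximal[OF closure_subset S(1)] by auto
    ultimately show "q \<in> interior ?C \<and> (\<exists>l<0. has_laplacian ?g l q)" by blast
  qed
  moreover have "w x0 * ?h x0 < 0"
    using barrier_pos[OF \<alpha>, of x0 y R] hole(2) x0(2) by (simp add: R_def mult_neg_pos)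
  ultimately show False by simp
qed

section \<open>Geometry of the domain\<close>

text \<open>The one consequence of convexity and symmetry that all later geometric steps
  use.\<close>

definition box_monotone :: "(real ^ 'n) set \<Rightarrow> bool" where
  "box_monotone S \<longleftrightarrow> (\<forall>x\<in>S. \<forall>z. (\<forall>j. \<bar>z $ j\<bar> \<le> \<bar>x $ j\<bar>) \<longrightarrow> z \<in> S)"

text \<open>The point \<open>z\<close> lies on the segment from \<open>x\<close> to its mirror
  image.\<close>

lemma convex_symmetric_slice:
  assumes "convex_in_direction i S" "symmetric_in_direction i S" "x \<in> S"
    and "\<And>j. j \<noteq> i \<Longrightarrow> z $ j = x $ j" "\<bar>z $ i\<bar> \<le> \<bar>x $ i\<bar>"
  shows "z \<in> S"
proof (cases "x $ i = 0")
  case True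
  then have "z $ j = x $ j" for j using assms(4)[of j] assms(5) by (cases "j = i") auto
  then have "z = x" by (simp add: vec_eq_iff)
  then show ?thesis using assms by simp
next
  case False
  \<comment> \<open>Solution of \<open>(1 - 2 * t) * x $ i = z $ i\<close>.\<close>
  define t where "t = (x $ i - z $ i) / (2 * x $ i)"
  have "closed_segment x (reflect_coord i x) \<subseteq> S"
    using assms(1-3) unfolding convex_in_direction_def symmetric_in_direction_def
    by (simp add: reflect_coord_def)
  moreover have "z = (1 - t) *\<^sub>R x + t *\<^sub>R reflect_coord i x"
    using assms(4) False by (auto simp: vec_eq_iff reflect_coord_def t_def field_simps)
  moreover have "0 \<le> t" "t \<le> 1"
    using assms(5) False by (auto simp: t_def divide_le_eq zero_le_divide_iff abs_if split: if_splits)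
  ultimately show ?thesis unfolding closed_segment_def by blast
qed

lemma box_monotoneI:
  fixes S :: "(real ^ 'n) set"
  assumes "\<And>i. convex_in_direction i S" "\<And>i. symmetric_in_direction i S"
  shows "box_monotone S"
  unfolding box_monotone_def
proof (intro ballI allI impI)
  fix x z :: "real ^ 'n" assume x: "x \<in> S" and z: "\<forall>j. \<bar>z $ j\<bar> \<le> \<bar>x $ j\<bar>"
  \<comment> \<open>The coordinates of \<open>x\<close> are replaced by those of \<open>z\<close>
    one at a time; \<open>A\<close> collects those already replaced.\<close>
  have "(\<chi> j. if j \<in> A then z $ j else x $ j) \<in> S" if "finite A" for A
    using that
  proof induction
    case empty then show ?case using x by simp
  next
    case (insert i A)
    show ?case
      by (rule convex_symmetric_slice[OF assms insert.IH]) (use insert.hyps z in auto)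
  qed
  from this[of UNIV] show "z \<in> S" by simp
qed

section \<open>Caps and the comparison function\<close>

text \<open>\<open>L\<close> is a Lipschitz constant of \<open>f\<close> on the values taken by
  \<open>u\<close>. The direction \<open>i\<close> does not occur in the predicate
  \<open>moving_plane \<Omega> u f L\<close>, so one instance serves all coordinates.\<close>

locale moving_plane =
  fixes \<Omega> :: "(real ^ 'n) set" and u :: "real ^ 'n \<Rightarrow> real" and f :: "real \<Rightarrow> real"
    and L :: real and i :: 'n
  assumes open_dom: "open \<Omega>" and bounded_dom: "bounded \<Omega>" and box: "box_monotone \<Omega>"
    and cont: "continuous_on (closure \<Omega>) u"
    and pos: "\<And>x. x \<in> \<Omega> \<Longrightarrow> u x > 0"
    and bdry: "\<And>x. x \<in> frontier \<Omega> \<Longrightarrow> u x = 0"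
    and L_nonneg: "L \<ge> 0"
    and lip: "\<And>x y. x \<in> \<Omega> \<Longrightarrow> y \<in> \<Omega> \<Longrightarrow> \<bar>f (u x) - f (u y)\<bar> \<le> L * \<bar>u x - u y\<bar>"
    and lap: "\<And>x. x \<in> \<Omega> \<Longrightarrow> has_laplacian u (- f (u x)) x"
begin

definition cap :: "real \<Rightarrow> (real ^ 'n) set" where "cap \<mu> = {x \<in> \<Omega>. x $ i > \<mu>}"

definition w :: "real \<Rightarrow> real ^ 'n \<Rightarrow> real" where "w \<mu> x = u (plane_reflect i \<mu> x) - u x"

lemma boxD: "x \<in> \<Omega> \<Longrightarrow> (\<And>j. \<bar>z $ j\<bar> \<le> \<bar>x $ j\<bar>) \<Longrightarrow> z \<in> \<Omega>"
  using box unfolding box_monotone_def by blast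

text \<open>For \<open>0 \<le> \<mu> < x $ i\<close> the reflected coordinate
  \<open>2 * \<mu> - x $ i\<close> is no larger in absolute value than \<open>x $ i\<close>.\<close>

lemma reflect_mem:
  assumes "\<mu> \<ge> 0" "x \<in> cap \<mu>"
  shows "plane_reflect i \<mu> x \<in> \<Omega>"
  by (rule boxD[of x]) (use assms in \<open>auto simp: cap_def plane_reflect_nth\<close>)

lemma open_cap: "open (cap \<mu>)"
proof -
  have "cap \<mu> = \<Omega> \<inter> {x. x $ i > \<mu>}" by (auto simp: cap_def)
  then show ?thesis using open_dom by (simp add: open_Int open_halfspace_component_gt_cart)
qed

lemma bounded_cap: "bounded (cap \<mu>)"
  by (rule bounded_subset[OF bounded_dom]) (auto simp: cap_def)

lemma u_nonneg: "x \<in> closure \<Omega> \<Longrightarrow> u x \<ge> 0"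
  using pos bdry closure_Un_frontier[of \<Omega>] by (force simp: less_imp_le)

lemma closure_cap:
  assumes "\<mu> \<ge> 0" "x \<in> closure (cap \<mu>)"
  shows "x \<in> closure \<Omega>" "x $ i \<ge> \<mu>" "plane_reflect i \<mu> x \<in> closure \<Omega>"
proof -
  show "x \<in> closure \<Omega>" using assms(2) closure_mono[of "cap \<mu>" \<Omega>] by (auto simp: cap_def)
  have "closure (cap \<mu>) \<subseteq> {x. x $ i \<ge> \<mu>}"
    by (rule closure_minimal) (auto simp: cap_def closed_halfspace_component_ge_cart)
  then show "x $ i \<ge> \<mu>" using assms(2) by auto
  have "plane_reflect i \<mu> ` closure (cap \<mu>) \<subseteq> closure \<Omega>"
    by (rule image_closure_subset[OF continuous_on_plane_reflect closed_closure])
       (use reflect_mem[OF assms(1)] closure_subset in blast)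
  then show "plane_reflect i \<mu> x \<in> closure \<Omega>" using assms(2) by auto
qed

lemma w_cont: "\<mu> \<ge> 0 \<Longrightarrow> continuous_on (closure (cap \<mu>)) (w \<mu>)"
  unfolding w_def
  by (intro continuous_intros continuous_on_compose2[OF cont] continuous_on_plane_reflect
        continuous_on_subset[OF cont])
     (auto dest: closure_cap)

text \<open>The boundary of a cap has two parts: points on the plane are fixed by the reflection,
  and on the frontier of the domain \<open>u\<close> vanishes while its reflected value is
  nonnegative.\<close>

lemma w_bdry:
  assumes "\<mu> \<ge> 0" "x \<in> closure (cap \<mu>)" "x \<notin> cap \<mu>"
  shows "w \<mu> x \<ge> 0"
proof (cases "x \<in> \<Omega>")
  case True
  then have "plane_reflect i \<mu> x = x"
    using assms closure_cap(2)[OF assms(1,2)] by (auto simp: cap_def vec_eq_iff plane_reflect_nth)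
  then show ?thesis by (simp add: w_def)
next
  case False
  then have "x \<in> frontier \<Omega>"
    using closure_cap(1)[OF assms(1,2)] open_dom by (simp add: frontier_def interior_open)
  then show ?thesis using bdry u_nonneg[OF closure_cap(3)[OF assms(1,2)]] by (simp add: w_def)
qed

text \<open>Subtract the equations at \<open>x\<close> and at its mirror image and use the Lipschitz
  bound.\<close>

lemma w_lap:
  assumes "\<mu> \<ge> 0" "x \<in> cap \<mu>"
  shows "\<exists>l. has_laplacian (w \<mu>) l x \<and> l \<le> L * \<bar>w \<mu> x\<bar>"
proof -
  have x: "x \<in> \<Omega>" "plane_reflect i \<mu> x \<in> \<Omega>" using assms reflect_mem by (auto simp: cap_def)
  have "has_laplacian (w \<mu>) (- f (u (plane_reflect i \<mu> x)) - - f (u x)) x"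
    unfolding w_def by (intro has_laplacian_diff has_laplacian_plane_reflect lap x)
  then show ?thesis using lip[OF x(2,1)] unfolding w_def by (intro exI conjI) (assumption, linarith)
qed

section \<open>Strong maximum principle on caps\<close>

text \<open>If \<open>w \<mu> y\<close> were positive, \<open>growth_lemma\<close> on the ball of
  radius \<open>r / 2\<close> about \<open>y\<close>, which contains \<open>z\<close> in its
  interior, would make \<open>w \<mu> z\<close> positive.\<close>

lemma zero_spreads:
  assumes \<mu>: "\<mu> \<ge> 0" "\<And>x. x \<in> cap \<mu> \<Longrightarrow> w \<mu> x \<ge> 0"
    and z: "ball z r \<subseteq> cap \<mu>" "w \<mu> z = 0" and y: "dist y z < r / 2"
  shows "w \<mu> y = 0"
proof (rule ccontr)
  assume "w \<mu> y \<noteq> 0"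
  have sub: "cball y (r / 2) \<subseteq> ball z r"
  proof
    fix x assume "x \<in> cball y (r / 2)"
    then show "x \<in> ball z r" using y dist_triangle[of z x y] by (auto simp: dist_commute)
  qed
  have "r > 0" using y zero_le_dist[of y z] by linarith
  then have "y \<in> cball y (r / 2)" by simp
  then have "y \<in> cap \<mu>" using sub z(1) by blast
  then have m: "w \<mu> y > 0" using \<mu>(2)[of y] \<open>w \<mu> y \<noteq> 0\<close> by simp
  have contc: "continuous_on (cap \<mu>) (w \<mu>)"
    using w_cont[OF \<mu>(1)] closure_subset continuous_on_subset by blast
  then have "isCont (w \<mu>) y" using \<open>y \<in> cap \<mu>\<close> open_cap by (simp add: continuous_on_eq_continuous_at)
  then obtain d where d: "d > 0" "\<And>x. dist x y < d \<Longrightarrow> dist (w \<mu> x) (w \<mu> y) < w \<mu> y / 2"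
    unfolding continuous_at_eps_delta using m by (meson half_gt_zero)
  obtain \<alpha> where \<alpha>: "\<alpha> > 0" "4 * \<alpha>\<^sup>2 * (d / 2)\<^sup>2 - 2 * real CARD('n) * \<alpha> > L"
    using barrier_exponent_exists[of "d / 2" L "CARD('n)"] d(1) L_nonneg by (auto simp: Suc_le_eq)
  have "w \<mu> z \<ge> w \<mu> y / 2 * barrier \<alpha> (r / 2) y z"
  proof (rule growth_lemma[where w = "w \<mu>" and L = L and \<rho> = "d / 2"])
    show "continuous_on (cball y (r / 2)) (w \<mu>)"
      using contc sub z(1) by (meson continuous_on_subset order_trans)
    show "0 \<le> w \<mu> x" if "x \<in> cball y (r / 2)" for x using \<mu>(2) that sub z(1) by blast
    show "w \<mu> y / 2 \<le> w \<mu> x" if "x \<in> cball y (d / 2)" for x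
      using d(2)[of x] that d(1) by (auto simp: dist_commute dist_real_def abs_if split: if_splits)
    show "\<exists>l. has_laplacian (w \<mu>) l x \<and> l \<le> L * w \<mu> x" if "x \<in> ball y (r / 2)" for x
    proof -
      have "x \<in> cap \<mu>" using that sub z(1) ball_subset_cball by blast
      then show ?thesis using w_lap[OF \<mu>(1)] \<mu>(2) by fastforce
    qed
    show "z \<in> cball y (r / 2)" using y by simp
  qed (use d m L_nonneg \<alpha> in auto)
  moreover have "barrier \<alpha> (r / 2) y z > 0" using barrier_pos[OF \<alpha>(1), of z y "r / 2"] y by (simp add: dist_commute)
  ultimately show False using m z(2) by (simp add: zero_less_mult_iff mult_le_0_iff)
qed

text \<open>Strictness of \<open>\<mu> > 0\<close> matters: it puts the mirror image of the boundary
  point that ends the ray inside the domain, whereas \<open>w 0\<close> vanishes on its cap by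
  symmetry.\<close>

lemma w_pos:
  assumes \<mu>: "\<mu> > 0" "\<And>x. x \<in> cap \<mu> \<Longrightarrow> w \<mu> x \<ge> 0" and x: "x \<in> cap \<mu>"
  shows "w \<mu> x > 0"
proof (rule ccontr)
  assume "\<not> w \<mu> x > 0"
  then have wx: "w \<mu> x = 0" using \<mu>(2)[OF x] by simp
  \<comment> \<open>Zeros propagate along the ray from \<open>x\<close> in direction \<open>i\<close> up to the boundary, where \<open>w \<mu>\<close> is positive.\<close>
  define p where "p = (\<lambda>s::real. x + s *\<^sub>R axis i (1::real))"
  have p_nth: "p s $ j = (if j = i then x $ i + s else x $ j)" for s j
    by (simp add: p_def axis_def)
  have dist_p: "dist (p s) (p t) = \<bar>s - t\<bar>" for s t
    by (simp add: p_def dist_norm scaleR_diff_left[symmetric])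
  define Z where "Z = {s. s \<ge> 0 \<and> p s \<in> cap \<mu> \<and> w \<mu> (p s) = 0}"
  have "0 \<in> Z" using x wx by (simp add: Z_def p_def)
  obtain B where B: "\<And>y. y \<in> \<Omega> \<Longrightarrow> norm y \<le> B" using bounded_dom bounded_iff by blast
  have "s \<le> B - x $ i" if "s \<in> Z" for s
  proof -
    have "p s \<in> \<Omega>" using that by (simp add: Z_def cap_def)
    then have "\<bar>p s $ i\<bar> \<le> B" using B component_le_norm_cart order_trans by blast
    then show ?thesis by (simp add: p_nth)
  qed
  then have bdd: "bdd_above Z" by (auto simp: bdd_above_def)
  define s0 where "s0 = Sup Z"
  have s0: "s0 \<in> closure Z" unfolding s0_def using closure_contains_Sup[OF _ bdd] \<open>0 \<in> Z\<close> by auto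
  have "s0 \<ge> 0" unfolding s0_def using cSup_upper[OF \<open>0 \<in> Z\<close> bdd] .
  let ?N = "{y \<in> closure (cap \<mu>). w \<mu> y = 0}"
  have "closed ?N"
    by (rule continuous_closed_preimage_constant[OF w_cont closed_closure]) (use \<mu>(1) in simp)
  moreover have "p ` Z \<subseteq> ?N" using closure_subset by (auto simp: Z_def)
  ultimately have "p ` closure Z \<subseteq> ?N"
    by (intro image_closure_subset) (auto simp: p_def intro!: continuous_intros)
  then have z: "p s0 \<in> closure (cap \<mu>)" "w \<mu> (p s0) = 0" using s0 by auto
  have zi: "p s0 $ i > \<mu>" using x \<open>s0 \<ge> 0\<close> by (simp add: p_nth cap_def)
  show False
  proof (cases "p s0 \<in> \<Omega>")
    case True
    then have "p s0 \<in> cap \<mu>" using zi by (simp add: cap_def)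
    then obtain r where r: "r > 0" "ball (p s0) r \<subseteq> cap \<mu>"
      using open_cap open_contains_ball by blast
    \<comment> \<open>A quarter of the radius stays in reach of \<open>zero_spreads\<close> and
      yields a zero beyond the supremum.\<close>
    have d: "dist (p (s0 + r / 4)) (p s0) < r / 2" using r(1) by (simp add: dist_p)
    have "w \<mu> (p (s0 + r / 4)) = 0"
      by (rule zero_spreads[OF _ \<mu>(2) r(2) z(2) d]) (use \<mu>(1) in auto)
    moreover have "p (s0 + r / 4) \<in> ball (p s0) r" using r(1) by (simp add: dist_p)
    then have "p (s0 + r / 4) \<in> cap \<mu>" using r(2) by blast
    ultimately have "s0 + r / 4 \<in> Z" using \<open>s0 \<ge> 0\<close> r(1) by (simp add: Z_def)
    then have "s0 + r / 4 \<le> s0" unfolding s0_def using cSup_upper bdd by blast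
    then show False using r(1) by simp
  next
    case False
    then have "p s0 \<in> frontier \<Omega>"
      using closure_cap(1)[OF _ z(1)] \<mu>(1) open_dom by (simp add: frontier_def interior_open)
    then have "u (plane_reflect i \<mu> (p s0)) = 0" using bdry z(2) by (simp add: w_def)
    moreover have "plane_reflect i \<mu> (p s0) \<in> \<Omega>"
    proof -
      \<comment> \<open>The mirror image has strictly smaller coordinate \<open>i\<close> in
        absolute value than \<open>p s0\<close>, so a point of the ray before \<open>s0\<close>,
        still in the domain, already dominates it.\<close>
      have "\<bar>2 * \<mu> - p s0 $ i\<bar> - x $ i < s0" using zi \<mu>(1) by (simp add: p_nth)
      then obtain s where s: "s \<in> Z" "\<bar>2 * \<mu> - p s0 $ i\<bar> - x $ i < s"
        unfolding s0_def using less_cSup_iff[OF _ bdd] \<open>0 \<in> Z\<close> by blast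
      show ?thesis
        by (rule boxD[of "p s"])
           (use s zi \<mu>(1) in \<open>auto simp: Z_def cap_def plane_reflect_nth p_nth\<close>)
    qed
    ultimately show False using pos by fastforce
  qed
qed

section \<open>Moving the plane down to the origin\<close>

text \<open>Push every coordinate of \<open>z\<close> away from 0 by \<epsilon>. Each point of the
  ball about the result dominates \<open>z\<close> coordinatewise, so if it were in the domain,
  \<open>z\<close> would be too.\<close>

lemma outside_hole:
  assumes "z \<notin> \<Omega>" "\<epsilon> > 0"
  shows "\<exists>y. cball y \<epsilon> \<inter> \<Omega> = {} \<and> dist z y \<le> real CARD('n) * \<epsilon>"
proof (intro exI conjI)
  define y where "y = (\<chi> j. if z $ j \<ge> 0 then z $ j + \<epsilon> else z $ j - \<epsilon>)"
  have "q \<notin> \<Omega>" if "q \<in> cball y \<epsilon>" for q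
  proof
    assume "q \<in> \<Omega>"
    have "\<bar>z $ j\<bar> \<le> \<bar>q $ j\<bar>" for j
    proof -
      have "\<bar>(y - q) $ j\<bar> \<le> \<epsilon>" using that component_le_norm_cart[of "y - q" j] by (simp add: dist_norm)
      then show ?thesis by (auto simp: y_def split: if_splits)
    qed
    then show False using boxD[OF \<open>q \<in> \<Omega>\<close>] assms(1) by blast
  qed
  then show "cball y \<epsilon> \<inter> \<Omega> = {}" by blast
  have "dist z y \<le> (\<Sum>j\<in>UNIV. \<bar>(z - y) $ j\<bar>)" unfolding dist_norm by (rule norm_le_l1_cart)
  also have "\<dots> \<le> (\<Sum>j\<in>(UNIV::'n set). \<epsilon>)" by (rule sum_mono) (use assms in \<open>auto simp: y_def\<close>)
  finally show "dist z y \<le> real CARD('n) * \<epsilon>" by simp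
qed

text \<open>On a compact core the positive minimum of \<open>w \<mu>0\<close> survives a small move
  of the plane. A negative minimum off the core lies near the frontier or near the plane, next to a
  ball missing the cap, which \<open>no_negative_min_near_hole\<close> forbids.\<close>

lemma nonneg_below:
  assumes \<mu>0: "\<mu>0 > 0" "\<And>x. x \<in> cap \<mu>0 \<Longrightarrow> w \<mu>0 x > 0"
  shows "\<exists>\<eta>>0. \<forall>\<mu>. 0 < \<mu> \<and> \<mu>0 - \<eta> < \<mu> \<and> \<mu> \<le> \<mu>0 \<longrightarrow> (\<forall>x\<in>cap \<mu>. w \<mu> x \<ge> 0)"
proof -
  define n where "n = real CARD('n)"
  \<comment> \<open>Large enough for both kinds of hole: \<open>n + 1\<close> near the frontier, 3
    near the plane.\<close>
  define \<kappa> where "\<kappa> = n + 3"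
  have n: "n \<ge> 1" by (simp add: n_def Suc_le_eq)
  define c where "c = 2 * n\<^sup>2 * exp (- n * \<kappa>\<^sup>2)"
  have c: "c > 0" using n by (simp add: c_def)
  \<comment> \<open>Chosen to give \<open>L * \<epsilon>\<^sup>2 < c\<close>, the smallness
    condition on the hole radius; \<open>L + 1\<close> guards against \<open>L = 0\<close>.\<close>
  define \<epsilon> where "\<epsilon> = min 1 (c / (2 * (L + 1)))"
  have \<epsilon>: "\<epsilon> > 0" "\<epsilon> \<le> 1" using c L_nonneg by (auto simp: \<epsilon>_def)
  have "(L + 1) * \<epsilon>\<^sup>2 \<le> (L + 1) * \<epsilon>"
    using \<epsilon> L_nonneg by (intro mult_left_mono) (auto simp: power2_eq_square mult_left_le)
  also have "\<dots> \<le> (L + 1) * (c / (2 * (L + 1)))"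
    using L_nonneg by (intro mult_left_mono) (auto simp: \<epsilon>_def)
  also have "\<dots> = c / 2" using L_nonneg by (simp add: field_simps)
  finally have "L * \<epsilon>\<^sup>2 + \<epsilon>\<^sup>2 \<le> c / 2" by (simp add: algebra_simps)
  then have small: "L * \<epsilon>\<^sup>2 < c" using c \<epsilon> by (smt (verit) zero_le_power2 field_sum_of_halves)
  define K where "K = {x. infdist x (- \<Omega>) \<ge> \<epsilon>} \<inter> {x. x $ i \<ge> \<mu>0 + \<epsilon>}"
  have K_sub: "K \<subseteq> cap \<mu>0"
  proof
    fix x assume x: "x \<in> K"
    have "x \<in> \<Omega>"
    proof (rule ccontr)
      assume "x \<notin> \<Omega>"
      then have "infdist x (- \<Omega>) = 0" by (intro infdist_zero) simp
      then show False using x \<epsilon>(1) by (simp add: K_def)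
    qed
    then show "x \<in> cap \<mu>0" using x \<epsilon>(1) by (simp add: K_def cap_def)
  qed
  have "closed K" unfolding K_def
    by (intro closed_Int closed_halfspace_component_ge_cart closed_Collect_le continuous_intros)
  then have "compact K"
    using K_sub bounded_cap bounded_subset compact_eq_bounded_closed by blast
  have sub0: "K \<subseteq> closure (cap \<mu>0)" using K_sub closure_subset by blast
  obtain m where m: "m > 0" "\<And>x. x \<in> K \<Longrightarrow> w \<mu>0 x \<ge> m"
  proof (cases "K = {}")
    case False
    obtain q where "q \<in> K" "\<And>x. x \<in> K \<Longrightarrow> w \<mu>0 q \<le> w \<mu>0 x"
      using continuous_attains_inf[OF \<open>compact K\<close> False continuous_on_subset[OF w_cont sub0]] \<mu>0(1)
      by auto
    then show ?thesis using that[of "w \<mu>0 q"] \<mu>0(2) K_sub by auto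
  qed (use that[of 1] in auto)
  have "uniformly_continuous_on (closure \<Omega>) u"
    using bounded_dom by (intro compact_uniformly_continuous cont) (simp add: compact_closure)
  then obtain d where d: "d > 0"
      "\<And>x y. x \<in> closure \<Omega> \<Longrightarrow> y \<in> closure \<Omega> \<Longrightarrow> dist y x < d \<Longrightarrow> dist (u y) (u x) < m"
    unfolding uniformly_continuous_on_def using m(1) by metis
  \<comment> \<open>Mirror images move twice as far as the plane, hence \<open>d / 2\<close>; the
    bound \<epsilon> keeps the hole below the plane in the last case.\<close>
  define \<eta> where "\<eta> = min \<epsilon> (d / 2)"
  have "w \<mu> x \<ge> 0" if \<mu>: "0 < \<mu>" "\<mu>0 - \<eta> < \<mu>" "\<mu> \<le> \<mu>0" and x: "x \<in> cap \<mu>" for \<mu> x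
  proof (rule ccontr)
    assume "\<not> w \<mu> x \<ge> 0"
    have cs: "cap \<mu> \<subseteq> closure (cap \<mu>)" by (rule closure_subset)
    obtain x0 where x0: "x0 \<in> closure (cap \<mu>)" "\<And>y. y \<in> closure (cap \<mu>) \<Longrightarrow> w \<mu> x0 \<le> w \<mu> y"
    proof -
      have "compact (closure (cap \<mu>))" using bounded_cap by (simp add: compact_closure)
      moreover have "closure (cap \<mu>) \<noteq> {}" using x cs by blast
      ultimately show thesis
        using continuous_attains_inf[OF _ _ w_cont] \<mu>(1) that by (meson less_imp_le)
    qed
    have neg: "w \<mu> x0 < 0" using x0(2)[of x] x cs \<open>\<not> w \<mu> x \<ge> 0\<close> by force
    then have x0c: "x0 \<in> cap \<mu>" using w_bdry[OF _ x0(1)] \<mu>(1) by force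
    have "x0 \<notin> K"
    proof
      assume "x0 \<in> K"
      then have mem: "plane_reflect i \<mu> x0 \<in> closure \<Omega>" "plane_reflect i \<mu>0 x0 \<in> closure \<Omega>"
        using reflect_mem[OF _ x0c] reflect_mem[of \<mu>0 x0] K_sub \<mu>(1) \<mu>0(1) closure_subset
        by (meson less_imp_le subsetD)+
      have "plane_reflect i \<mu> x0 - plane_reflect i \<mu>0 x0 = (2 * (\<mu> - \<mu>0)) *\<^sub>R axis i 1"
        by (auto simp: vec_eq_iff plane_reflect_nth axis_def)
      then have "dist (plane_reflect i \<mu> x0) (plane_reflect i \<mu>0 x0) = 2 * (\<mu>0 - \<mu>)"
        using \<mu>(3) by (simp add: dist_norm)
      also have "\<dots> < d" using \<mu>(2) by (simp add: \<eta>_def min_def split: if_splits)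
      finally have "dist (u (plane_reflect i \<mu> x0)) (u (plane_reflect i \<mu>0 x0)) < m"
        by (rule d(2)[OF mem(2,1)])
      then have "w \<mu> x0 > w \<mu>0 x0 - m" unfolding w_def dist_real_def by linarith
      then show False using m(2)[OF \<open>x0 \<in> K\<close>] neg by linarith
    qed
    have "\<exists>y. cball y \<epsilon> \<inter> cap \<mu> = {} \<and> dist x0 y < \<kappa> * \<epsilon>"
    proof (cases "x0 $ i \<ge> \<mu>0 + \<epsilon>")
      case True
      then have "infdist x0 (- \<Omega>) < \<epsilon>" using \<open>x0 \<notin> K\<close> by (auto simp: K_def)
      moreover have "- \<Omega> \<noteq> {}" using bounded_dom not_bounded_UNIV by (metis double_complement compl_bot_eq)
      ultimately obtain z where z: "z \<notin> \<Omega>" "dist x0 z < \<epsilon>"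
        using infdist_attains_inf[of "- \<Omega>" x0] open_dom by (metis ComplD closed_Compl)
      obtain y where y: "cball y \<epsilon> \<inter> \<Omega> = {}" "dist z y \<le> n * \<epsilon>"
        using outside_hole[OF z(1) \<epsilon>(1)] by (auto simp: n_def)
      have "dist x0 y < \<epsilon> + n * \<epsilon>" using dist_triangle[of x0 y z] z y by linarith
      also have "\<dots> \<le> \<kappa> * \<epsilon>" using \<epsilon>(1) by (simp add: \<kappa>_def algebra_simps)
      finally show ?thesis using y(1) by (auto simp: cap_def)
    next
      case False
      \<comment> \<open>The ball of radius \<epsilon> about this point reaches only up to
        \<open>x0 $ i - 2 * \<epsilon>\<close>, which is less than \<mu>.\<close>
      define y where "y = x0 - (3 * \<epsilon>) *\<^sub>R axis i 1"
      have "q \<notin> cap \<mu>" if "q \<in> cball y \<epsilon>" for q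
      proof -
        have "\<bar>(y - q) $ i\<bar> \<le> \<epsilon>" using that component_le_norm_cart[of "y - q" i] by (simp add: dist_norm)
        then have "q $ i \<le> x0 $ i - 2 * \<epsilon>" by (simp add: y_def)
        then show ?thesis using False \<mu>(2) by (auto simp: cap_def \<eta>_def)
      qed
      moreover have "dist x0 y < \<kappa> * \<epsilon>" using \<epsilon> n by (simp add: y_def dist_norm \<kappa>_def)
      ultimately show ?thesis by blast
    qed
    then obtain y where y: "cball y \<epsilon> \<inter> cap \<mu> = {}" "dist x0 y < \<kappa> * \<epsilon>" by blast
    show False
      by (rule no_negative_min_near_hole[of "cap \<mu>" "w \<mu>" L x0 y \<epsilon> \<kappa>])
         (use open_cap bounded_cap w_cont w_bdry w_lap x0c neg x0(2) y \<mu>(1) \<epsilon>(1) n L_nonneg small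
           in \<open>auto simp: \<kappa>_def n_def c_def\<close>)
  qed
  moreover have "\<eta> > 0" using \<epsilon> d by (simp add: \<eta>_def)
  ultimately show ?thesis by blast
qed

text \<open>For fixed \<open>x\<close>, \<open>w \<nu> x\<close> tends to \<open>w \<mu> x\<close>
  as \<nu> decreases to \<mu>, and \<open>x\<close> lies in \<open>cap \<nu>\<close> while
  \<open>\<nu> < x $ i\<close>.\<close>

lemma nonneg_limit:
  assumes "\<mu> \<ge> 0" "\<And>\<nu> x. \<nu> > \<mu> \<Longrightarrow> x \<in> cap \<nu> \<Longrightarrow> w \<nu> x \<ge> 0" "x \<in> cap \<mu>"
  shows "w \<mu> x \<ge> 0"
proof -
  have "isCont u (plane_reflect i \<mu> x)"
    using reflect_mem[OF assms(1,3)] continuous_on_subset[OF cont closure_subset] open_dom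
    by (simp add: continuous_on_eq_continuous_at)
  moreover have "((\<lambda>\<nu>. plane_reflect i \<nu> x) \<longlongrightarrow> plane_reflect i \<mu> x) (at_right \<mu>)"
    unfolding plane_reflect_def by (intro tendsto_intros)
  ultimately have "((\<lambda>\<nu>. w \<nu> x) \<longlongrightarrow> w \<mu> x) (at_right \<mu>)"
    unfolding w_def by (intro tendsto_diff[OF isCont_tendsto_compose tendsto_const])
  moreover have "\<forall>\<^sub>F \<nu> in at_right \<mu>. w \<nu> x \<ge> 0"
    using assms(2,3) by (intro eventually_at_rightI[of _ "x $ i"]) (auto simp: cap_def)
  ultimately show ?thesis by (rule tendsto_lowerbound) simp
qed

text \<open>Caps far out are empty, so the bad positions are bounded above. Their supremum is good
  by the limit, then positions just below it are good by \<open>nonneg_below\<close>, which is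
  absurd. Position 0 is reached by the limit.\<close>

lemma w_nonneg:
  assumes "\<mu> \<ge> 0" "x \<in> cap \<mu>"
  shows "w \<mu> x \<ge> 0"
proof -
  define Bad where "Bad = {\<nu>. \<nu> > 0 \<and> (\<exists>x\<in>cap \<nu>. w \<nu> x < 0)}"
  have "Bad = {}"
  proof (rule ccontr)
    assume "Bad \<noteq> {}"
    then obtain \<nu> where \<nu>: "\<nu> \<in> Bad" by blast
    obtain B where B: "\<And>y. y \<in> \<Omega> \<Longrightarrow> norm y \<le> B" using bounded_dom bounded_iff by blast
    have "\<nu> \<le> B" if bad: "\<nu> \<in> Bad" for \<nu>
    proof -
      obtain x where "x \<in> \<Omega>" "x $ i > \<nu>" using bad unfolding Bad_def cap_def by blast
      then show ?thesis using B[of x] component_le_norm_cart[of x i] by linarith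
    qed
    then have bdd: "bdd_above Bad" by (auto simp: bdd_above_def)
    define \<mu>0 where "\<mu>0 = Sup Bad"
    have "\<mu>0 > 0" unfolding \<mu>0_def using cSup_upper[OF \<nu> bdd] \<nu> by (auto simp: Bad_def)
    have above: "w \<nu> x \<ge> 0" if "\<nu> > \<mu>0" "x \<in> cap \<nu>" for \<nu> x
      using that cSup_upper[OF _ bdd, of \<nu>] \<open>\<mu>0 > 0\<close> by (force simp: Bad_def \<mu>0_def)
    have at: "w \<mu>0 x \<ge> 0" if "x \<in> cap \<mu>0" for x
      by (rule nonneg_limit[OF _ above that]) (use \<open>\<mu>0 > 0\<close> in auto)
    obtain \<eta> where \<eta>: "\<eta> > 0"
        "\<And>\<mu> x. 0 < \<mu> \<Longrightarrow> \<mu>0 - \<eta> < \<mu> \<Longrightarrow> \<mu> \<le> \<mu>0 \<Longrightarrow> x \<in> cap \<mu> \<Longrightarrow> w \<mu> x \<ge> 0"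
      using nonneg_below[OF \<open>\<mu>0 > 0\<close> w_pos[OF \<open>\<mu>0 > 0\<close> at]] by blast
    obtain \<mu> where "\<mu> \<in> Bad" "\<mu>0 - \<eta> < \<mu>"
      using less_cSup_iff[OF _ bdd, of "\<mu>0 - \<eta>"] \<nu> \<eta>(1) by (auto simp: \<mu>0_def)
    moreover have "\<mu> \<le> \<mu>0" unfolding \<mu>0_def using cSup_upper[OF _ bdd] calculation(1) by blast
    ultimately show False using \<eta>(2)[of \<mu>] by (force simp: Bad_def)
  qed
  then have "w \<nu> y \<ge> 0" if "\<nu> > 0" "y \<in> cap \<nu>" for \<nu> y
    using that unfolding Bad_def by force
  then show ?thesis using nonneg_limit[OF assms(1) _ assms(2)] assms(1) by force
qed

section \<open>Evenness of the solution\<close>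

text \<open>Lets the plane arrive from the opposite side, by applying the results above to the
  mirror image of the solution.\<close>

lemma reflected: "moving_plane \<Omega> (\<lambda>x. u (plane_reflect i 0 x)) f L"
proof
  let ?r = "plane_reflect i 0"
  have mem: "?r x \<in> \<Omega>" if "x \<in> \<Omega>" for x
    by (rule boxD[OF that]) (simp add: plane_reflect_nth)
  have clos: "?r x \<in> closure \<Omega>" if "x \<in> closure \<Omega>" for x
  proof -
    have "?r ` closure \<Omega> \<subseteq> closure \<Omega>"
      by (rule image_closure_subset[OF continuous_on_plane_reflect closed_closure])
         (use mem closure_subset in blast)
    then show ?thesis using that by auto
  qed
  show "continuous_on (closure \<Omega>) (\<lambda>x. u (?r x))"
    by (rule continuous_on_compose2[OF cont continuous_on_plane_reflect]) (use clos in auto)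
  show "u (?r x) = 0" if "x \<in> frontier \<Omega>" for x
  proof (rule bdry)
    have "?r x \<notin> \<Omega>" using mem[of "?r x"] that open_dom by (auto simp: frontier_def interior_open)
    then show "?r x \<in> frontier \<Omega>"
      using that clos[of x] open_dom by (simp add: frontier_def interior_open)
  qed
  show "u (?r x) > 0" if "x \<in> \<Omega>" for x
    using pos mem[OF that] by blast
  show "\<bar>f (u (?r x)) - f (u (?r y))\<bar> \<le> L * \<bar>u (?r x) - u (?r y)\<bar>" if "x \<in> \<Omega>" "y \<in> \<Omega>" for x y
    using lip mem that by blast
  show "has_laplacian (\<lambda>x. u (?r x)) (- f (u (?r x))) x" if "x \<in> \<Omega>" for x
    using has_laplacian_plane_reflect lap mem that by blast
qed (use open_dom bounded_dom box L_nonneg in simp_all)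

text \<open>At position 0 the inequality for \<open>u\<close> and the one for its mirror image are
  opposite to each other.\<close>

lemma symmetric:
  assumes "x \<in> \<Omega>"
  shows "u (plane_reflect i 0 x) = u x"
proof -
  have pos_side: "u (plane_reflect i 0 x) = u x" if "x \<in> \<Omega>" "x $ i > 0" for x
    using w_nonneg[of 0 x] moving_plane.w_nonneg[OF reflected, where i = i and \<mu> = 0 and x = x] that
    by (simp add: cap_def w_def moving_plane.cap_def[OF reflected] moving_plane.w_def[OF reflected])
  consider "x $ i > 0" | "x $ i = 0" | "x $ i < 0" by linarith
  then show ?thesis
  proof cases
    case 2
    then have "plane_reflect i 0 x = x" by (simp add: vec_eq_iff plane_reflect_nth)
    then show ?thesis by simp
  next
    case 3
    have "plane_reflect i 0 x \<in> \<Omega>" by (rule boxD[OF assms]) (simp add: plane_reflect_nth)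
    then show ?thesis using pos_side[of "plane_reflect i 0 x"] 3 by (simp add: plane_reflect_nth)
  qed (use pos_side assms in blast)
qed

section \<open>Strict sign of the pure second derivatives at the origin\<close>

text \<open>Barrier comparison in a ball touching the origin gives, in the limit of difference
  quotients, that \<open>- g\<close> is at least a positive multiple of the barrier along the axis.
  Both vanish at 0, where the barrier has positive slope.\<close>

lemma second_deriv_at_0_neg:
  assumes zero: "0 \<in> \<Omega>"
    and g: "\<And>x. x \<in> \<Omega> \<Longrightarrow> ((\<lambda>t. u (x + t *\<^sub>R axis i 1)) has_real_derivative g x) (at 0)"
    and g_cont: "continuous_on \<Omega> g"
    and c: "((\<lambda>t. g (t *\<^sub>R axis i 1)) has_real_derivative c) (at 0)"
  shows "c < 0"
proof -
  define e where "e = (axis i 1 :: real ^ 'n)"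
  have e: "norm e = 1" "e $ i = 1" by (simp_all add: e_def)
  have line: "((\<lambda>t. u (x + t *\<^sub>R e)) has_real_derivative g (x + s *\<^sub>R e)) (at s)"
    if "x + s *\<^sub>R e \<in> \<Omega>" for x s
    using g[OF that] DERIV_shift[of "\<lambda>t. u (x + t *\<^sub>R e)" "g (x + s *\<^sub>R e)" 0 s]
    by (simp add: e_def algebra_simps)
  \<comment> \<open>Points of the closed ball about \<open>y\<close> used below have norm less than
    \<open>2 * r\<close>, and shifts add at most \<open>r\<close>.\<close>
  obtain r where r: "r > 0" "ball 0 (4 * r) \<subseteq> \<Omega>"
  proof -
    obtain r0 where "r0 > 0" "ball 0 r0 \<subseteq> \<Omega>" using zero open_dom open_contains_ball by blast
    then show thesis using that[of "r0 / 4"] by simp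
  qed
  have in_dom: "x \<in> \<Omega>" if "norm x < 4 * r" for x using r(2) that by auto
  \<comment> \<open>The plane halfway between the origin and \<open>r *\<^sub>R e\<close> exchanges
    the two, so \<open>u\<close> is strictly smaller at the latter and the mean value theorem finds
    a point with \<open>g\<close> negative.\<close>
  have "w (r / 2) (r *\<^sub>R e) > 0"
    by (rule w_pos[OF _ w_nonneg]) (use r in_dom e in \<open>auto simp: cap_def\<close>)
  moreover have "plane_reflect i (r / 2) (r *\<^sub>R e) = 0"
    by (simp add: vec_eq_iff plane_reflect_nth e_def axis_def)
  ultimately have drop: "u (r *\<^sub>R e) < u 0" by (simp add: w_def)
  obtain t where t: "0 < t" "t < r" "g (t *\<^sub>R e) < 0"
  proof -
    have "\<exists>z>0. z < r \<and> u (0 + r *\<^sub>R e) - u (0 + 0 *\<^sub>R e) = (r - 0) * g (0 + z *\<^sub>R e)"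
      by (rule MVT2[of 0 r "\<lambda>t. u (0 + t *\<^sub>R e)"], use r in simp, rule line)
         (use r in_dom e in auto)
    then obtain z where z: "0 < z" "z < r" "u (r *\<^sub>R e) - u 0 = r * g (z *\<^sub>R e)" by auto
    then have "r * g (z *\<^sub>R e) < 0" using drop by linarith
    then show thesis using that z r(1) by (simp add: mult_less_0_iff)
  qed
  \<comment> \<open>The ball of radius \<open>t\<close> about this centre has the origin on its
    sphere.\<close>
  define y where "y = t *\<^sub>R e"
  \<comment> \<open>Half of \<open>- g y\<close>, so that \<open>g \<le> - k\<close> persists near
    \<open>y\<close>.\<close>
  define k where "k = - g y / 2"
  have k: "k > 0" using t by (simp add: k_def y_def)
  have y: "y \<in> \<Omega>" "norm y = t" using t in_dom e by (simp_all add: y_def)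
  have "isCont g y" using g_cont y open_dom by (simp add: continuous_on_eq_continuous_at)
  then obtain d where d: "d > 0" "\<And>x. dist x y < d \<Longrightarrow> dist (g x) (g y) < k"
    unfolding continuous_at_eps_delta using k by blast
  \<comment> \<open>The other half of \<open>d\<close> is left for the shift \<sigma>.\<close>
  define \<rho> where "\<rho> = d / 2"
  obtain \<alpha> where \<alpha>: "\<alpha> > 0" "4 * \<alpha>\<^sup>2 * \<rho>\<^sup>2 - 2 * real CARD('n) * \<alpha> > L"
    using barrier_exponent_exists[of \<rho> L "CARD('n)"] d(1) L_nonneg by (auto simp: Suc_le_eq \<rho>_def)
  have near: "x + \<tau> *\<^sub>R e \<in> \<Omega>"
    if "x \<in> cball y t" "\<bar>\<tau>\<bar> \<le> r" for x \<tau>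
  proof -
    have "norm (x + \<tau> *\<^sub>R e) \<le> norm x + \<bar>\<tau>\<bar>" using norm_triangle_ineq[of x "\<tau> *\<^sub>R e"] e by simp
    moreover have "norm x \<le> norm y + dist y x" unfolding dist_norm using norm_triangle_sub[of x y]
      by (simp add: norm_minus_commute)
    ultimately have "norm (x + \<tau> *\<^sub>R e) < 4 * r" using that y t by simp
    then show ?thesis by (rule in_dom)
  qed
  have quotient: "u (x + (- \<sigma>) *\<^sub>R e) - u (x + \<sigma> *\<^sub>R e) \<ge> 2 * \<sigma> * k * barrier \<alpha> t y x"
    if \<sigma>: "0 < \<sigma>" "\<sigma> < min r \<rho>" and x: "x \<in> cball y t" for x \<sigma>
  proof -
    let ?v = "\<lambda>x. u (x + (- \<sigma>) *\<^sub>R e) - u (x + \<sigma> *\<^sub>R e)"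
    have in1: "x + (- \<sigma>) *\<^sub>R e \<in> \<Omega>" "x + \<sigma> *\<^sub>R e \<in> \<Omega>" if "x \<in> cball y t" for x
      using near[OF that, of "- \<sigma>"] near[OF that, of \<sigma>] \<sigma> by auto
    have nonneg: "?v x \<ge> 0" if x: "x \<in> cball y t" for x
    proof -
      have "\<bar>(y - x) $ i\<bar> \<le> t" using component_le_norm_cart[of "y - x" i] x by (simp add: dist_norm)
      \<comment> \<open>Hence the plane through \<open>x\<close> is an admissible position; it
        exchanges the two shifted points.\<close>
      then have "x $ i \<ge> 0" using e by (simp add: y_def)
      moreover have "x + \<sigma> *\<^sub>R e \<in> cap (x $ i)" using in1(2)[OF x] \<sigma> e by (simp add: cap_def)
      ultimately have "w (x $ i) (x + \<sigma> *\<^sub>R e) \<ge> 0" by (rule w_nonneg)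
      moreover have "plane_reflect i (x $ i) (x + \<sigma> *\<^sub>R e) = x + (- \<sigma>) *\<^sub>R e"
        by (auto simp: vec_eq_iff plane_reflect_nth e_def axis_def)
      ultimately show ?thesis by (simp add: w_def)
    qed
    have "?v x \<ge> (2 * \<sigma> * k) * barrier \<alpha> t y x"
    proof (rule growth_lemma[where w = ?v and L = L and \<rho> = \<rho>])
      show "continuous_on (cball y t) ?v"
        by (intro continuous_intros continuous_on_compose2[OF cont])
           (use in1 closure_subset[of \<Omega>] in auto)
      show "0 \<le> ?v x" if "x \<in> cball y t" for x using that by (rule nonneg)
      show "2 * \<sigma> * k \<le> ?v x" if x: "x \<in> cball y \<rho>" "x \<in> cball y t" for x
      proof -
        have "\<exists>z>-\<sigma>. z < \<sigma> \<and> u (x + \<sigma> *\<^sub>R e) - u (x + (- \<sigma>) *\<^sub>R e) = (\<sigma> - - \<sigma>) * g (x + z *\<^sub>R e)"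
          by (rule MVT2[of "- \<sigma>" \<sigma> "\<lambda>t. u (x + t *\<^sub>R e)"], use \<sigma> in simp, rule line, rule near)
             (use \<sigma> x in auto)
        then obtain z where z: "-\<sigma> < z" "z < \<sigma>"
          "u (x + \<sigma> *\<^sub>R e) - u (x + (- \<sigma>) *\<^sub>R e) = 2 * \<sigma> * g (x + z *\<^sub>R e)" by auto
        have "dist (x + z *\<^sub>R e) y \<le> dist x y + \<bar>z\<bar>"
          using norm_triangle_ineq[of "x - y" "z *\<^sub>R e"] e by (simp add: dist_norm algebra_simps)
        also have "\<dots> < d" using z x \<sigma> by (auto simp: dist_commute \<rho>_def)
        finally have "dist (g (x + z *\<^sub>R e)) (g y) < k" by (rule d(2))
        then have "g (x + z *\<^sub>R e) \<le> - k" by (auto simp: dist_real_def k_def abs_if field_simps split: if_splits)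
        then have "2 * \<sigma> * g (x + z *\<^sub>R e) \<le> 2 * \<sigma> * (- k)" using \<sigma> by (intro mult_left_mono) auto
        then show ?thesis using z(3) by simp
      qed
      show "\<exists>l. has_laplacian ?v l x \<and> l \<le> L * ?v x" if "x \<in> ball y t" for x
      proof -
        have xc: "x \<in> cball y t" using that by simp
        have "has_laplacian ?v (- f (u (x + (- \<sigma>) *\<^sub>R e)) - - f (u (x + \<sigma> *\<^sub>R e))) x"
          by (intro has_laplacian_diff has_laplacian_shift lap in1 xc)
        then show ?thesis using lip[OF in1(2,1)[OF xc]] nonneg[OF xc]
          by (intro exI conjI) (assumption, simp add: abs_if split: if_splits)
      qed
    qed (use d k \<sigma> \<alpha> L_nonneg x in \<open>auto simp: \<rho>_def\<close>)
    then show ?thesis .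
  qed
  \<comment> \<open>Division of \<open>quotient\<close> by \<open>2 * \<sigma>\<close> and passage
    to the limit, phrased by contradiction: otherwise a function vanishing at 0 with positive
    derivative there violates \<open>quotient\<close> for small shifts.\<close>
  have bound: "g (a *\<^sub>R e) + k * barrier \<alpha> t y (a *\<^sub>R e) \<le> 0" if a: "0 < a" "a < t" for a
  proof (rule ccontr)
    define h where "h = barrier \<alpha> t y (a *\<^sub>R e)"
    assume "\<not> ?thesis"
    then have gh: "2 * (g (a *\<^sub>R e) + k * h) > 0" by (simp add: h_def)
    have ac: "a *\<^sub>R e \<in> cball y t"
      using a e by (simp add: y_def dist_norm scaleR_diff_left[symmetric])
    have "a *\<^sub>R e + 0 *\<^sub>R e \<in> \<Omega>" using near[OF ac, of 0] r by simp
    then have D: "((\<lambda>s. u (a *\<^sub>R e + s *\<^sub>R e)) has_real_derivative g (a *\<^sub>R e)) (at 0)"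
      using line[of "a *\<^sub>R e" 0] by simp
    then have D': "((\<lambda>s. u (a *\<^sub>R e + (- s) *\<^sub>R e)) has_real_derivative - g (a *\<^sub>R e)) (at 0)"
      using DERIV_mirror[of "\<lambda>s. u (a *\<^sub>R e + s *\<^sub>R e)" "g (a *\<^sub>R e)" 0] by simp
    have "((\<lambda>s. u (a *\<^sub>R e + s *\<^sub>R e) - u (a *\<^sub>R e + (- s) *\<^sub>R e) + s * (2 * k * h))
        has_real_derivative (g (a *\<^sub>R e) - - g (a *\<^sub>R e) + 2 * k * h)) (at 0)"
      by (intro DERIV_add DERIV_diff D D') (auto intro!: derivative_eq_intros)
    from DERIV_pos_inc_right[OF this] gh obtain \<delta> where \<delta>: "\<delta> > 0"
      "\<And>s. 0 < s \<Longrightarrow> s < \<delta> \<Longrightarrow> u (a *\<^sub>R e + s *\<^sub>R e) - u (a *\<^sub>R e + (- s) *\<^sub>R e) + s * (2 * k * h) > 0"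
      by (auto simp: algebra_simps)
    define s where "s = min \<delta> (min r \<rho>) / 2"
    have s: "0 < s" "s < \<delta>" "s < min r \<rho>" using \<delta>(1) r(1) d(1) by (auto simp: s_def \<rho>_def)
    show False using quotient[OF s(1,3) ac] \<delta>(2)[OF s(1,2)] by (simp add: h_def algebra_simps)
  qed
  \<comment> \<open>Evenness along the axis makes the derivative equal to its negative.\<close>
  have "g 0 = 0"
  proof -
    have D: "((\<lambda>s. u (s *\<^sub>R e)) has_real_derivative g 0) (at 0)" using line[of 0 0] zero by simp
    have D': "((\<lambda>s. u ((- s) *\<^sub>R e)) has_real_derivative - g 0) (at 0)"
      using DERIV_mirror[of "\<lambda>s. u (s *\<^sub>R e)" "g 0" 0] D by simp
    have "\<forall>\<^sub>F s in nhds 0. u ((- s) *\<^sub>R e) = u (s *\<^sub>R e)"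
    proof (rule eventually_mono)
      show "\<forall>\<^sub>F s in nhds 0. 0 + s *\<^sub>R axis i 1 \<in> \<Omega>" by (rule eventually_axis_line[OF open_dom zero])
      fix s :: real assume "0 + s *\<^sub>R axis i 1 \<in> \<Omega>"
      moreover have "plane_reflect i 0 (s *\<^sub>R e) = (- s) *\<^sub>R e"
        by (simp add: vec_eq_iff plane_reflect_nth e_def axis_def)
      ultimately show "u ((- s) *\<^sub>R e) = u (s *\<^sub>R e)" using symmetric[of "s *\<^sub>R e"] by (simp add: e_def)
    qed
    then have "((\<lambda>s. u (s *\<^sub>R e)) has_real_derivative - g 0) (at 0)"
      using D' by (rule has_real_derivative_transfer)
    from DERIV_unique[OF D this] show ?thesis by simp
  qed
  have "((\<lambda>a. g (a *\<^sub>R e) + k * (exp (- \<alpha> * (a - t)\<^sup>2) - exp (- \<alpha> * t\<^sup>2)))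
      has_real_derivative (c + k * (2 * \<alpha> * t * exp (- \<alpha> * t\<^sup>2)))) (at 0)"
    by (intro DERIV_add) (use c in \<open>auto simp: e_def intro!: derivative_eq_intros\<close>)
  moreover have "barrier \<alpha> t y (a *\<^sub>R e) = exp (- \<alpha> * (a - t)\<^sup>2) - exp (- \<alpha> * t\<^sup>2)" for a
    using e by (simp add: barrier_def y_def dist_norm scaleR_diff_left[symmetric])
  ultimately have D: "((\<lambda>a. g (a *\<^sub>R e) + k * barrier \<alpha> t y (a *\<^sub>R e))
      has_real_derivative (c + k * (2 * \<alpha> * t * exp (- \<alpha> * t\<^sup>2)))) (at 0)" by simp
  \<comment> \<open>The differentiated function vanishes at 0 and is nonpositive just to the
    right.\<close>
  have "c + k * (2 * \<alpha> * t * exp (- \<alpha> * t\<^sup>2)) \<le> 0"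
  proof (rule ccontr)
    assume "\<not> ?thesis"
    then obtain \<delta> where \<delta>: "\<delta> > 0" "\<And>s. 0 < s \<Longrightarrow> s < \<delta> \<Longrightarrow>
        g (s *\<^sub>R e) + k * barrier \<alpha> t y (s *\<^sub>R e) > g 0 + k * barrier \<alpha> t y 0"
      using DERIV_pos_inc_right[OF D] by auto
    define s where "s = min \<delta> t / 2"
    have s: "0 < s" "s < \<delta>" "s < t" using \<delta>(1) t(1) by (auto simp: s_def)
    have "barrier \<alpha> t y 0 = 0" using y by (simp add: barrier_def)
    then show False using \<delta>(2)[OF s(1,2)] bound[OF s(1,3)] \<open>g 0 = 0\<close> by simp
  qed
  moreover have "k * (2 * \<alpha> * t * exp (- \<alpha> * t\<^sup>2)) > 0" using k \<alpha>(1) t(1) by simp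
  ultimately show ?thesis by linarith
qed

end

section \<open>Derivatives along the axes, mixed derivatives and diagonal matrices\<close>

lemma real_derivative_along_axis:
  fixes u :: "real ^ 'n \<Rightarrow> real"
  assumes "(u has_derivative (\<lambda>h. D \<bullet> h)) (at (p + s *\<^sub>R axis j 1))"
  shows "((\<lambda>t. u (p + t *\<^sub>R axis j 1)) has_real_derivative D $ j) (at s)"
proof -
  have "((\<lambda>t. p + t *\<^sub>R axis j 1) has_derivative (\<lambda>t. t *\<^sub>R axis j 1)) (at s)"
    by (auto intro!: derivative_eq_intros)
  from has_derivative_compose[OF this assms]
  have "((\<lambda>t. u (p + t *\<^sub>R axis j 1)) has_derivative (\<lambda>t. D \<bullet> (t *\<^sub>R axis j 1))) (at s)" .
  moreover have "(\<lambda>t. D \<bullet> (t *\<^sub>R axis j 1)) = (*) (D $ j)"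
    by (auto simp: inner_axis)
  ultimately show ?thesis unfolding has_field_derivative_def by simp
qed

lemma gradient_derivative_along_axis:
  fixes Du :: "real ^ 'n \<Rightarrow> real ^ 'n"
  assumes "(Du has_derivative (\<lambda>h. H *v h)) (at (p + s *\<^sub>R axis j 1))"
  shows "((\<lambda>t. Du (p + t *\<^sub>R axis j 1) $ k) has_real_derivative H $ k $ j) (at s)"
proof -
  have "((\<lambda>x. Du x $ k) has_derivative (\<lambda>h. (H *v h) $ k)) (at (p + s *\<^sub>R axis j 1))"
    using bounded_linear.has_derivative[OF bounded_linear_vec_nth assms] .
  moreover have "(H *v h) $ k = H $ k \<bullet> h" for h
    by (simp add: matrix_vector_mul_component)
  ultimately show ?thesis using real_derivative_along_axis[of "\<lambda>x. Du x $ k" "H $ k"] by simp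
qed

lemma has_laplacian_hessian:
  fixes u :: "real ^ 'n \<Rightarrow> real"
  assumes "open S" "p \<in> S"
    and grad: "\<And>x. x \<in> S \<Longrightarrow> (u has_derivative (\<lambda>h. Du x \<bullet> h)) (at x)"
    and hess: "(Du has_derivative (\<lambda>h. H *v h)) (at p)"
  shows "has_laplacian u (\<Sum>j\<in>UNIV. H $ j $ j) p"
  unfolding has_laplacian_def
proof (intro exI conjI allI)
  fix j
  show "has_second_deriv (\<lambda>t. u (p + t *\<^sub>R axis j 1)) (H $ j $ j)"
  proof (rule has_second_derivI)
    show "\<forall>\<^sub>F t in nhds 0. ((\<lambda>t. u (p + t *\<^sub>R axis j 1)) has_real_derivative Du (p + t *\<^sub>R axis j 1) $ j) (at t)"
      using eventually_axis_line[OF assms(1,2), of j]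
      by eventually_elim (intro real_derivative_along_axis grad)
    show "((\<lambda>t. Du (p + t *\<^sub>R axis j 1) $ j) has_real_derivative H $ j $ j) (at 0)"
      by (rule gradient_derivative_along_axis) (use hess in simp)
  qed
qed simp

text \<open>The continuous derivative is bounded on a compact interval. An interval containing the
  values of \<open>u\<close> then supplies the constant of \<open>moving_plane\<close>.\<close>

lemma C1_lipschitz_on_interval:
  fixes f :: "real \<Rightarrow> real"
  assumes "f C1_differentiable_on UNIV"
  shows "\<exists>L\<ge>0. \<forall>x\<in>{a..b}. \<forall>y\<in>{a..b}. \<bar>f x - f y\<bar> \<le> L * \<bar>x - y\<bar>"
proof -
  obtain D where D: "\<And>x. (f has_vector_derivative D x) (at x)" "continuous_on UNIV D"
    using assms unfolding C1_differentiable_on_def by blast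
  have "compact (D ` {a..b})"
    by (intro compact_continuous_image continuous_on_subset[OF D(2)]) auto
  then have "bounded (D ` {a..b})" by (rule compact_imp_bounded)
  then obtain L where L: "L > 0" "\<And>x. x \<in> {a..b} \<Longrightarrow> norm (D x) \<le> L"
    unfolding bounded_pos by blast
  have "norm (f x - f y) \<le> L * norm (x - y)" if "x \<in> {a..b}" "y \<in> {a..b}" for x y
    by (rule field_differentiable_bound[of "{a..b}" f D])
       (use that L D(1) in \<open>auto simp: has_real_derivative_iff_has_vector_derivative
          intro: has_vector_derivative_at_within\<close>)
  then show ?thesis using L(1) by (intro exI[of _ L]) auto
qed

text \<open>For \<open>j \<noteq> i\<close> the derivative of \<open>u\<close> in direction
  \<open>j\<close> is again even in coordinate \<open>i\<close>, and the derivative of an even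
  function vanishes at 0.\<close>

lemma mixed_derivative_eq_0:
  fixes Du :: "real ^ 'n \<Rightarrow> real ^ 'n"
  assumes S: "open S" "0 \<in> S" and mem: "\<And>x. x \<in> S \<Longrightarrow> plane_reflect i 0 x \<in> S"
    and sym: "\<And>x. x \<in> S \<Longrightarrow> u (plane_reflect i 0 x) = u x"
    and grad: "\<And>x. x \<in> S \<Longrightarrow> (u has_derivative (\<lambda>h. Du x \<bullet> h)) (at x)"
    and hess: "(Du has_derivative (\<lambda>h. H *v h)) (at 0)"
    and "j \<noteq> i"
  shows "H $ j $ i = 0"
proof -
  have even: "Du (plane_reflect i 0 x) $ j = Du x $ j" if x: "x \<in> S" for x
  proof -
    have D: "((\<lambda>t. u (x + t *\<^sub>R axis j 1)) has_real_derivative Du x $ j) (at 0)"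
      by (rule real_derivative_along_axis) (use grad[OF x] in simp)
    have D': "((\<lambda>t. u (plane_reflect i 0 x + t *\<^sub>R axis j 1)) has_real_derivative
        Du (plane_reflect i 0 x) $ j) (at 0)"
      by (rule real_derivative_along_axis) (use grad[OF mem[OF x]] in simp)
    have "\<forall>\<^sub>F t in nhds 0. u (plane_reflect i 0 x + t *\<^sub>R axis j 1) = u (x + t *\<^sub>R axis j 1)"
      using eventually_axis_line[OF S(1) x, of j]
      by eventually_elim (use sym plane_reflect_axis[of i 0 x _ j] \<open>j \<noteq> i\<close> in force)
    then have "((\<lambda>t. u (x + t *\<^sub>R axis j 1)) has_real_derivative Du (plane_reflect i 0 x) $ j) (at 0)"
      using D' by (rule has_real_derivative_transfer)
    from DERIV_unique[OF D this] show ?thesis by simp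
  qed
  have D: "((\<lambda>t. Du (t *\<^sub>R axis i 1) $ j) has_real_derivative H $ j $ i) (at 0)"
    using gradient_derivative_along_axis[of Du H 0 0 i j] hess by simp
  then have D': "((\<lambda>t. Du ((- t) *\<^sub>R axis i 1) $ j) has_real_derivative - (H $ j $ i)) (at 0)"
    using DERIV_mirror[of "\<lambda>t. Du (t *\<^sub>R axis i 1) $ j" "H $ j $ i" 0] by simp
  have "\<forall>\<^sub>F t in nhds 0. Du ((- t) *\<^sub>R axis i 1) $ j = Du (t *\<^sub>R axis i 1) $ j"
  proof (rule eventually_mono[OF eventually_axis_line[OF S, of i]])
    fix t :: real assume "0 + t *\<^sub>R axis i 1 \<in> S"
    moreover have "plane_reflect i 0 (t *\<^sub>R axis i 1) = (- t) *\<^sub>R axis i 1"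
      by (simp add: vec_eq_iff plane_reflect_nth axis_def)
    ultimately show "Du ((- t) *\<^sub>R axis i 1) $ j = Du (t *\<^sub>R axis i 1) $ j"
      using even[of "t *\<^sub>R axis i 1"] by simp
  qed
  then have "((\<lambda>t. Du (t *\<^sub>R axis i 1) $ j) has_real_derivative - (H $ j $ i)) (at 0)"
    using D' by (rule has_real_derivative_transfer)
  from DERIV_unique[OF D this] show ?thesis by simp
qed

lemma negative_definite_diagonal:
  fixes A :: "real ^ 'n ^ 'n"
  assumes "diagonal_matrix A" "\<And>i. A $ i $ i < 0"
  shows "negative_definite A"
  unfolding negative_definite_def
proof (intro allI impI)
  fix v :: "real ^ 'n" assume "v \<noteq> 0"
  then obtain k where k: "v $ k \<noteq> 0" by (auto simp: vec_eq_iff)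
  have "(A *v v) $ i = A $ i $ i * v $ i" for i
  proof -
    have "(A *v v) $ i = (\<Sum>j\<in>UNIV. if j = i then A $ i $ i * v $ i else 0)"
      unfolding matrix_vector_mult_def vec_lambda_beta using assms(1)
      by (intro sum.cong) (auto simp: diagonal_matrix_def)
    then show ?thesis by simp
  qed
  then have "v \<bullet> (A *v v) = (\<Sum>i\<in>UNIV. A $ i $ i * (v $ i)\<^sup>2)"
    by (simp add: inner_vec_def power2_eq_square mult_ac)
  also have "\<dots> < (\<Sum>i\<in>(UNIV::'n set). 0)"
    by (rule sum_strict_mono_ex1)
       (use assms(2) k in \<open>auto simp: mult_le_0_iff mult_less_0_iff less_imp_le intro!: exI[of _ k]\<close>)
  finally show "v \<bullet> (A *v v) < 0" by simp
qed

section \<open>The Hessian at the origin\<close>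

theorem theorem2p1:
  fixes \<Omega> :: "(real ^ 'n) set"
    and f :: "real \<Rightarrow> real"
    and u :: "real ^ 'n \<Rightarrow> real"
    and Du :: "real ^ 'n \<Rightarrow> real ^ 'n"
    and Hu :: "real ^ 'n \<Rightarrow> real ^ 'n ^ 'n"
  assumes dom: "open \<Omega>" "connected \<Omega>" "bounded \<Omega>" "\<Omega> \<noteq> {}"
    and conv: "\<forall>i. convex_in_direction i \<Omega>"
    and symm: "\<forall>i. symmetric_in_direction i \<Omega>"
    and f_C1: "f C1_differentiable_on UNIV"
    and grad: "\<forall>x\<in>\<Omega>. (u has_derivative (\<lambda>h. Du x \<bullet> h)) (at x)"
    and hess: "\<forall>x\<in>\<Omega>. (Du has_derivative (\<lambda>h. Hu x *v h)) (at x)"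
    and hess_cont: "continuous_on \<Omega> Hu"
    and u_cont: "continuous_on (closure \<Omega>) u"
    and pde: "\<forall>x\<in>\<Omega>. - (\<Sum>i\<in>UNIV. Hu x $ i $ i) = f (u x)"
    and pos: "\<forall>x\<in>\<Omega>. u x > 0"
    and bdry: "\<forall>x\<in>frontier \<Omega>. u x = 0"
  shows "diagonal_matrix (Hu 0) \<and> negative_definite (Hu 0)"
proof -
  have box: "box_monotone \<Omega>" using conv symm by (intro box_monotoneI) auto
  \<comment> \<open>The box spanned by any point of the domain contains the origin.\<close>
  then have zero: "0 \<in> \<Omega>" using dom(4) unfolding box_monotone_def by fastforce
  have "bounded (u ` closure \<Omega>)"
    using dom(3) by (intro compact_imp_bounded compact_continuous_image u_cont) (simp add: compact_closure)
  then obtain B where B: "\<And>x. x \<in> \<Omega> \<Longrightarrow> \<bar>u x\<bar> \<le> B"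
    unfolding bounded_iff using closure_subset[of \<Omega>] by auto
  obtain L where L: "L \<ge> 0" "\<And>x y. x \<in> {-B..B} \<Longrightarrow> y \<in> {-B..B} \<Longrightarrow> \<bar>f x - f y\<bar> \<le> L * \<bar>x - y\<bar>"
    using C1_lipschitz_on_interval[OF f_C1] by metis
  have mp: "moving_plane \<Omega> u f L"
  proof
    show "\<bar>f (u x) - f (u y)\<bar> \<le> L * \<bar>u x - u y\<bar>" if "x \<in> \<Omega>" "y \<in> \<Omega>" for x y
      using L(2)[of "u x" "u y"] B[OF that(1)] B[OF that(2)] by (simp add: abs_le_iff)
    show "has_laplacian u (- f (u x)) x" if "x \<in> \<Omega>" for x
    proof -
      have "has_laplacian u (\<Sum>j\<in>UNIV. Hu x $ j $ j) x"
        by (rule has_laplacian_hessian[OF dom(1) that]) (use grad hess that in auto)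
      moreover have "(\<Sum>j\<in>UNIV. Hu x $ j $ j) = - f (u x)" using pde that by force
      ultimately show ?thesis by simp
    qed
  qed (use dom box u_cont pos bdry L(1) in simp_all)
  have "Hu 0 $ j $ i = 0" if "j \<noteq> i" for i j
  proof (rule mixed_derivative_eq_0[where S = \<Omega> and u = u and Du = Du])
    show "j \<noteq> i" by (rule that)
    show "u (plane_reflect i 0 x) = u x" if "x \<in> \<Omega>" for x by (rule moving_plane.symmetric[OF mp that])
    show "plane_reflect i 0 x \<in> \<Omega>" if "x \<in> \<Omega>" for x
      by (rule moving_plane.boxD[OF mp that]) (simp add: plane_reflect_nth)
  qed (use dom(1) grad hess zero in simp_all)
  then have diag: "diagonal_matrix (Hu 0)" unfolding diagonal_matrix_def by blast
  have Du_cont: "continuous_on \<Omega> Du"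
    using hess has_derivative_continuous continuous_at_imp_continuous_on by blast
  have "Hu 0 $ i $ i < 0" for i
  proof (rule moving_plane.second_deriv_at_0_neg[OF mp zero])
    show "((\<lambda>t. u (x + t *\<^sub>R axis i 1)) has_real_derivative Du x $ i) (at 0)" if "x \<in> \<Omega>" for x
      by (rule real_derivative_along_axis) (use grad that in simp)
    show "continuous_on \<Omega> (\<lambda>x. Du x $ i)" by (intro continuous_intros Du_cont)
    show "((\<lambda>t. Du (t *\<^sub>R axis i 1) $ i) has_real_derivative Hu 0 $ i $ i) (at 0)"
      using gradient_derivative_along_axis[of Du "Hu 0" 0 0 i i] hess zero by simp
  qed
  then show ?thesis using diag negative_definite_diagonal by blast
qed

end
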